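(* Let $0<\alpha<1$. Then there exist a compact set $E\subset\mathbb R$, a Borel probability measure $\mu$ on $\mathbb R$ supported on $E$, and constants $0<c\le C<\infty$ such that $$|\hat\mu(\xi)|\le C|\xi|^{-\alpha/2}\quad\text{for all }\xi\in\mathbb R,\ \xi\ne 0,$$ and $$c\,\frac{|I|^\alpha}{\log(1/|I|)}\le \mu(I)\le C\,\frac{|I|^\alpha}{\log(1/|I|)}$$ for all intervals $I\subset\mathbb R$ centered in $E$ with $0<|I|<1/2$.
   Context: For a finite Borel measure $\mu$ on $\mathbb R$, $\hat\mu(\xi)=\int_{\mathbb R}e^{-2\pi i\xi x}\,d\mu(x)$. A Borel probability measure $\mu$ is said to be supported on a set $E$ if $\mu(E)=1$. For an interval $I$, $|I|$ denotes its length; $I$ is centered in $E$ if its midpoint belongs to $E$. $\log$ is the natural logarithm. The constants $c,C$ do not depend on $\xi$ or $I$. *)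

theory Defs
  imports "HOL-Probability.Probability"
begin

text \<open>Unlike \<^const>\<open>char\<close>, which integrates \<open>exp (i t x)\<close>, this uses the
  normalisation \<open>exp (- 2 \<pi> i \<xi> x)\<close>.\<close>

definition fourier_measure :: "real measure \<Rightarrow> real \<Rightarrow> complex" where
  "fourier_measure \<mu> \<xi> = (CLINT x|\<mu>. exp (- (2 * complex_of_real pi * \<i> * complex_of_real \<xi> * complex_of_real x)))"

text \<open>Length and midpoint are meaningful only for nonempty bounded intervals, which may be
  open, closed or half-open.\<close>

definition interval_length :: "real set \<Rightarrow> real" where
  "interval_length I = Sup I - Inf I"

definition interval_midpoint :: "real set \<Rightarrow> real" where
  "interval_midpoint I = (Inf I + Sup I) / 2"

definition bounded_interval :: "real set \<Rightarrow> bool" where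
  "bounded_interval I \<longleftrightarrow> is_interval I \<and> bounded I \<and> I \<noteq> {}"

definition centered_in :: "real set \<Rightarrow> real set \<Rightarrow> bool" where
  "centered_in I E \<longleftrightarrow> interval_midpoint I \<in> E"

end

theory Submission
  imports Defs
begin

text \<open>Build a Cantor set from dyadic intervals: every interval of level \<open>k\<close> has either both of its
  halves or exactly one of them at level \<open>k + 1\<close>, the choice between ``two'' and ``one'' depending only
  on \<open>k\<close>, so that all \<open>2 ^ s k\<close> intervals of level \<open>k\<close> have the same mass.
  Taking \<open>2 ^ s k\<close> comparable to \<open>2 powr (\<alpha> k) * (k + 1)\<close> makes the mass bounds
  hold whichever halves are chosen.

  At a one-child level the Fourier transform changes by a signed sum of \<open>2 ^ s k\<close> unimodular terms, times
  \<open>2 ^ (- s k)\<close> and a factor at most \<open>min 1 (2 ^ k / \<xi>)\<close>.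
  Signs that keep all these sums, over the countable net of frequencies \<open>\<xi> = sqrt j\<close>, below
  \<open>9 * sqrt (2 ^ s k * ln (j + 2))\<close> exist by a greedy choice that keeps a weighted series of \<open>cosh\<close>
  potentials from growing. The extra factor \<open>k + 1\<close> in the number of intervals absorbs this logarithm, and
  the series of differences is dominated geometrically around \<open>2 ^ k = \<xi>\<close>. The net suffices because
  it is \<open>1 / \<xi>\<close>-dense near \<open>\<xi>\<close> and the Fourier transform is Lipschitz.\<close>

section \<open>Balancing signs\<close>

text \<open>Hoeffding's lemma for a fair sign: with exponent \<open>2*x\<close> and probability 1/2,
  its auxiliary inequality bounds the logarithm of \<open>exp x * cosh x\<close>. Negative
  \<open>x\<close> follows since both sides are even.\<close>

lemma cosh_le_exp_half_square: "cosh (x::real) \<le> exp (x\<^sup>2 / 2)"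
proof -
  have *: "cosh x \<le> exp (x\<^sup>2 / 2)" if "x \<ge> 0" for x :: real
  proof -
    have pos: "1 + (1/2) * (exp (2*x) - 1) > (0::real)"
      using exp_gt_zero[of "2*x"] by (simp add: field_simps add_pos_pos)
    have "- (2*x) * (1/2) + ln (1 + (1/2) * (exp (2*x) - 1)) \<le> (2*x)\<^sup>2 / 8"
      using that by (intro Hoeffdings_lemma_aux) auto
    hence "ln (1 + (1/2) * (exp (2*x) - 1)) \<le> x + x\<^sup>2 / 2"
      by (simp add: power2_eq_square)
    hence "1 + (1/2) * (exp (2*x) - 1) \<le> exp (x + x\<^sup>2 / 2)"
      using pos by (metis exp_le_cancel_iff exp_ln)
    moreover have "1 + (1/2) * (exp (2*x) - 1) = exp x * cosh x"
      by (simp add: cosh_def field_simps flip: exp_add)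
    ultimately show ?thesis by (simp add: exp_add)
  qed
  show ?thesis using *[of x] *[of "-x"] by (cases "x \<ge> 0") auto
qed

text \<open>Signs are fixed one element at a time. By the addition formula, averaging over the two
  signs of a new \<open>x\<close> multiplies the \<open>j\<close>-th potential by
  \<open>cosh (l j * a j x)\<close>, which is at most \<open>exp ((l j)\<^sup>2 / 2)\<close>. Hence
  one sign keeps the whole series within that average, for all \<open>j\<close> at once.\<close>

lemma greedy_signs:
  fixes a :: "nat \<Rightarrow> 'a \<Rightarrow> real" and l w :: "nat \<Rightarrow> real"
  assumes "finite A" and a: "\<And>j q. \<bar>a j q\<bar> \<le> 1" and w: "\<And>j. w j \<ge> 0"
    and summ: "summable (\<lambda>j. w j * exp (card A * (l j)\<^sup>2 / 2))"
  shows "\<exists>\<epsilon>. (\<forall>q. \<epsilon> q \<in> {-1, 1}) \<and>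
           summable (\<lambda>j. w j * cosh (l j * (\<Sum>q\<in>A. \<epsilon> q * a j q))) \<and>
           (\<Sum>j. w j * cosh (l j * (\<Sum>q\<in>A. \<epsilon> q * a j q))) \<le> (\<Sum>j. w j * exp (card A * (l j)\<^sup>2 / 2))"
  using assms(1) w summ
proof (induction A arbitrary: w rule: finite_induct)
  case empty
  then show ?case by (intro exI[of _ "\<lambda>_. 1"]) auto
next
  case (insert x A)
  \<comment> \<open>The cost of the new element is moved into the weight, so that the induction
    hypothesis for \<open>A\<close> already carries the bound for \<open>insert x A\<close>.\<close>
  define w' where "w' = (\<lambda>j. w j * exp ((l j)\<^sup>2 / 2))"
  have w'eq: "w' j * exp (card A * (l j)\<^sup>2 / 2) = w j * exp (card (insert x A) * (l j)\<^sup>2 / 2)" for j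
    using insert.hyps by (simp add: w'_def algebra_simps add_divide_distrib flip: exp_add)
  obtain \<epsilon> where \<epsilon>: "\<And>q. \<epsilon> q \<in> {-1, 1 :: real}"
    and s: "summable (\<lambda>j. w' j * cosh (l j * (\<Sum>q\<in>A. \<epsilon> q * a j q)))"
    and le: "(\<Sum>j. w' j * cosh (l j * (\<Sum>q\<in>A. \<epsilon> q * a j q))) \<le> (\<Sum>j. w j * exp (card (insert x A) * (l j)\<^sup>2 / 2))"
    using insert.IH[of w'] insert.prems unfolding w'eq by (auto simp: w'_def)
  define S where "S = (\<lambda>j. \<Sum>q\<in>A. \<epsilon> q * a j q)"
  define f where "f = (\<lambda>\<sigma> j. w j * cosh (l j * (S j + \<sigma> * a j x)))"
  have f0: "f \<sigma> j \<ge> 0" for \<sigma> j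
    using insert.prems(1) by (simp add: f_def)
  have f2: "f 1 j + f (-1) j \<le> 2 * (w' j * cosh (l j * S j))" for j
  proof -
    have "f 1 j + f (-1) j = w j * (2 * (cosh (l j * S j) * cosh (l j * a j x)))"
      by (simp add: f_def algebra_simps cosh_add cosh_diff)
    also have "\<dots> \<le> w j * (2 * (cosh (l j * S j) * exp ((l j)\<^sup>2 / 2)))"
    proof (intro mult_left_mono insert.prems)
      have "(l j * a j x)\<^sup>2 \<le> (l j)\<^sup>2 * 1"
        unfolding power_mult_distrib using a[of j x]
        by (intro mult_left_mono) (auto simp: abs_square_le_1)
      hence "exp ((l j * a j x)\<^sup>2 / 2) \<le> exp ((l j)\<^sup>2 / 2)" by simp
      with cosh_le_exp_half_square[of "l j * a j x"]
      show "cosh (l j * a j x) \<le> exp ((l j)\<^sup>2 / 2)" by (rule order_trans)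
    qed auto
    also have "\<dots> = 2 * (w' j * cosh (l j * S j))"
      by (simp add: w'_def)
    finally show ?thesis .
  qed
  have s2: "summable (\<lambda>j. 2 * (w' j * cosh (l j * S j)))"
    using s unfolding S_def by (rule summable_mult)
  have sf: "summable (f 1)" "summable (f (-1))"
    by (rule summable_comparison_test'[OF s2, of 0];
        use f0 f2 in \<open>auto simp: abs_of_nonneg intro: order_trans[OF _ f2]\<close>)+
  have "suminf (f 1) + suminf (f (-1)) \<le> (\<Sum>j. 2 * (w' j * cosh (l j * S j)))"
    unfolding suminf_add[OF sf] by (intro suminf_le f2 summable_add sf s2)
  also have "\<dots> = 2 * (\<Sum>j. w' j * cosh (l j * S j))"
    using s unfolding S_def by (rule suminf_mult)
  \<comment> \<open>The smaller of two numbers with sum at most 2 M is at most M.\<close>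
  finally obtain \<sigma> where \<sigma>: "\<sigma> \<in> {-1, 1::real}" "suminf (f \<sigma>) \<le> (\<Sum>j. w' j * cosh (l j * S j))"
    by (cases "suminf (f 1) \<le> suminf (f (-1))") force+
  have eq: "f \<sigma> j = w j * cosh (l j * (\<Sum>q\<in>insert x A. (\<epsilon>(x := \<sigma>)) q * a j q))" for j
  proof -
    have "(\<Sum>q\<in>A. (\<epsilon>(x := \<sigma>)) q * a j q) = S j"
      unfolding S_def using insert.hyps by (intro sum.cong) auto
    thus ?thesis using insert.hyps by (simp add: f_def add.commute del: fun_upd_apply) simp
  qed
  show ?case
  proof (intro exI[of _ "\<epsilon>(x := \<sigma>)"] conjI allI)
    show "(\<epsilon>(x := \<sigma>)) q \<in> {-1, 1}" for q using \<epsilon> \<sigma> by auto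
  qed (unfold eq[symmetric], use \<sigma> sf le S_def in \<open>auto\<close>)
qed

lemma sums_reciprocal_telescope: "(\<lambda>j. 1 / (real j + 1) - 1 / (real j + 2)) sums 1"
proof -
  have "(\<lambda>j. 1 / (real j + 1)) \<longlonglongrightarrow> 0" by real_asymp
  from telescope_sums'[OF this] show ?thesis by (simp add: add_ac)
qed

text \<open>With \<open>l j\<close> chosen so that \<open>n * (l j)\<^sup>2 / 2 = L j\<close>, the
  exponential equals \<open>real j + 2\<close>; cubic weights then make the total potential at most
  1. Every single \<open>cosh\<close> is therefore at most \<open>(real j + 2) ^ 3\<close>, and
  taking logarithms bounds the sum.\<close>

lemma balancing_signs_real:
  fixes a :: "nat \<Rightarrow> 'a \<Rightarrow> real"
  assumes "finite A" "A \<noteq> {}" and a: "\<And>j q. \<bar>a j q\<bar> \<le> 1"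
  obtains \<epsilon> where "\<And>q. \<epsilon> q \<in> {-1, 1}"
    "\<And>j. \<bar>\<Sum>q\<in>A. \<epsilon> q * a j q\<bar> \<le> 3 * sqrt (card A * ln (real j + 2))"
proof -
  define n where "n = real (card A)"
  have n: "n > 0" using assms by (simp add: n_def card_gt_0_iff)
  define L where "L = (\<lambda>j::nat. ln (real j + 2))"
  have L: "L j > 0" for j by (simp add: L_def)
  define l where "l = (\<lambda>j. sqrt (2 * L j / n))"
  define w where "w = (\<lambda>j::nat. 1 / (real j + 2) ^ 3)"
  have l0: "l j > 0" for j using L[of j] n by (simp add: l_def)
  have l2: "n * (l j)\<^sup>2 / 2 = L j" for j
    using L[of j] n by (simp add: l_def)
  have weq: "w j * exp (n * (l j)\<^sup>2 / 2) \<le> 1 / (real j + 1) - 1 / (real j + 2)" for j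
  proof -
    have "w j * exp (n * (l j)\<^sup>2 / 2) = 1 / (real j + 2)\<^sup>2"
      unfolding l2 by (simp add: w_def L_def power3_eq_cube power2_eq_square)
    also have "\<dots> \<le> 1 / ((real j + 1) * (real j + 2))"
      by (intro divide_left_mono) (auto simp: power2_eq_square)
    also have "\<dots> = 1 / (real j + 1) - 1 / (real j + 2)"
      by (simp add: field_simps)
    finally show ?thesis .
  qed
  have sw: "summable (\<lambda>j. w j * exp (n * (l j)\<^sup>2 / 2))"
    by (rule summable_comparison_test'[OF sums_summable[OF sums_reciprocal_telescope], of 0])
       (use weq in \<open>auto simp: w_def\<close>)
  have le1: "(\<Sum>j. w j * exp (n * (l j)\<^sup>2 / 2)) \<le> 1"
    using suminf_le[OF weq sw sums_summable[OF sums_reciprocal_telescope]]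
    by (simp add: sums_unique[OF sums_reciprocal_telescope, symmetric])
  obtain \<epsilon> where \<epsilon>: "\<And>q. \<epsilon> q \<in> {-1, 1 :: real}"
    and s: "summable (\<lambda>j. w j * cosh (l j * (\<Sum>q\<in>A. \<epsilon> q * a j q)))"
    and le: "(\<Sum>j. w j * cosh (l j * (\<Sum>q\<in>A. \<epsilon> q * a j q))) \<le> 1"
  proof -
    have w0: "w j \<ge> 0" for j by (simp add: w_def)
    show ?thesis
      using greedy_signs[where A = A and a = a and l = l and w = w, OF assms(1) a w0] sw le1 that order_trans[OF _ le1]
      unfolding n_def by blast
  qed
  have "\<bar>\<Sum>q\<in>A. \<epsilon> q * a j q\<bar> \<le> 3 * sqrt (card A * ln (real j + 2))" for j
  proof -
    define S where "S = (\<Sum>q\<in>A. \<epsilon> q * a j q)"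
    have "(\<Sum>j\<in>{j}. w j * cosh (l j * (\<Sum>q\<in>A. \<epsilon> q * a j q))) \<le> 1"
      by (rule order_trans[OF sum_le_suminf[OF s] le]) (auto simp: w_def)
    hence c: "cosh (l j * S) \<le> (real j + 2) ^ 3"
      by (simp add: w_def S_def divide_le_eq)
    have "exp \<bar>l j * S\<bar> \<le> 2 * cosh (l j * S)"
      using exp_gt_zero[of "l j * S"] exp_gt_zero[of "- (l j * S)"]
      by (simp add: cosh_def abs_if)
    \<comment> \<open>The factor 2 is absorbed into one more power of \<open>real j + 2\<close>;
      this makes the exponent 4 and the final constant \<open>sqrt 8\<close>, rounded up to
      3.\<close>
    also have "\<dots> \<le> (real j + 2) * (real j + 2) ^ 3"
      using c by (intro mult_mono) auto
    also have "\<dots> = exp (4 * L j)"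
      using exp_of_nat_mult[of 4 "L j"] by (simp add: L_def eval_nat_numeral)
    finally have "l j * \<bar>S\<bar> \<le> 4 * L j"
      using l0[of j] by (simp add: abs_mult)
    hence "\<bar>S\<bar> \<le> 4 * L j / l j"
      using l0[of j] by (simp add: field_simps)
    also have "\<dots> = sqrt (8 * (n * L j))"
    proof (rule real_sqrt_unique[symmetric])
      show "(4 * L j / l j)\<^sup>2 = 8 * (n * L j)"
        using L[of j] n by (simp add: l_def power_divide power_mult_distrib)
          (simp add: field_simps power2_eq_square)
      show "0 \<le> 4 * L j / l j" using l0[of j] L[of j] by simp
    qed
    also have "\<dots> \<le> sqrt (9 * (n * L j))"
      using n L[of j] by (intro real_sqrt_le_mono mult_right_mono) auto
    also have "\<dots> = 3 * sqrt (card A * ln (real j + 2))"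
      by (simp add: real_sqrt_mult n_def L_def)
    finally show ?thesis by (simp add: S_def)
  qed
  with \<epsilon> that show thesis by blast
qed

text \<open>Real and imaginary parts are interleaved into one real sequence, at even and odd
  indices. Doubling the index at most doubles the logarithm, because \<open>2 * j + 3\<close> is at
  most the square of \<open>j + 2\<close>.\<close>

lemma balancing_signs:
  fixes z :: "nat \<Rightarrow> 'a \<Rightarrow> complex"
  assumes "finite A" "A \<noteq> {}" and z: "\<And>j q. cmod (z j q) \<le> 1"
  obtains \<epsilon> where "\<And>q. \<epsilon> q \<in> {-1, 1::real}"
    "\<And>j. cmod (\<Sum>q\<in>A. of_real (\<epsilon> q) * z j q) \<le> 9 * sqrt (card A * ln (real j + 2))"
proof -
  define a where "a = (\<lambda>i q. if even i then Re (z (i div 2) q) else Im (z (i div 2) q))"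
  have a1: "\<bar>a i q\<bar> \<le> 1" for i q
    unfolding a_def using order_trans[OF abs_Re_le_cmod z] order_trans[OF abs_Im_le_cmod z] by auto
  obtain \<epsilon> where \<epsilon>: "\<And>q. \<epsilon> q \<in> {-1, 1::real}"
    and le: "\<And>i. \<bar>\<Sum>q\<in>A. \<epsilon> q * a i q\<bar> \<le> 3 * sqrt (card A * ln (real i + 2))"
    using balancing_signs_real[where a = a, OF assms(1,2) a1] by metis
  have "cmod (\<Sum>q\<in>A. of_real (\<epsilon> q) * z j q) \<le> 9 * sqrt (card A * ln (real j + 2))" for j
  proof -
    define B where "B = sqrt (card A * ln (real j + 2))"
    have B0: "B \<ge> 0" by (simp add: B_def)
    have *: "3 * sqrt (card A * ln (real i + 2)) \<le> (9/2) * B" if "i \<le> 2 * j + 1" for i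
    proof -
      have "real i + 2 \<le> (real j + 2)\<^sup>2"
      proof -
        have "real i \<le> 2 * real j + 1" using that by linarith
        hence "real i + 2 \<le> 2 * real j + 1 + 2" by simp
        also have "2 * real j + 1 + 2 \<le> (real j + 2)\<^sup>2"
          by (simp add: power2_eq_square algebra_simps)
        finally show ?thesis by simp
      qed
      hence "ln (real i + 2) \<le> ln ((real j + 2)\<^sup>2)"
        by (subst ln_le_cancel_iff) auto
      also have "\<dots> = 2 * ln (real j + 2)" by (simp add: ln_realpow)
      \<comment> \<open>Relaxed to a rational square, so that each part gets the constant 3 * 3/2 =
        9/2 and both together 9.\<close>
      also have "\<dots> \<le> (9/4) * ln (real j + 2)" by (intro mult_right_mono) auto
      finally have "ln (real i + 2) \<le> (9/4) * ln (real j + 2)" .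
      from mult_left_mono[OF this, of "real (card A)"]
      have "sqrt (card A * ln (real i + 2)) \<le> sqrt ((9/4) * (card A * ln (real j + 2)))"
        by (intro real_sqrt_le_mono) (simp add: mult.left_commute)
      also have "\<dots> = (3/2) * B" by (simp add: real_sqrt_mult real_sqrt_divide B_def)
      finally show ?thesis by simp
    qed
    have "Re (\<Sum>q\<in>A. of_real (\<epsilon> q) * z j q) = (\<Sum>q\<in>A. \<epsilon> q * a (2 * j) q)"
         "Im (\<Sum>q\<in>A. of_real (\<epsilon> q) * z j q) = (\<Sum>q\<in>A. \<epsilon> q * a (2 * j + 1) q)"
      by (simp_all add: a_def)
    hence "\<bar>Re (\<Sum>q\<in>A. of_real (\<epsilon> q) * z j q)\<bar> \<le> (9/2) * B"
          "\<bar>Im (\<Sum>q\<in>A. of_real (\<epsilon> q) * z j q)\<bar> \<le> (9/2) * B"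
      using le[of "2*j"] le[of "2*j+1"] *[of "2*j"] *[of "2*j+1"] by simp_all
    thus ?thesis using cmod_le[of "\<Sum>q\<in>A. of_real (\<epsilon> q) * z j q"] unfolding B_def by linarith
  qed
  with \<epsilon> that show thesis by blast
qed

section \<open>The measure carried by a dyadic tree\<close>

text \<open>The intervals of level \<open>k\<close> are \<open>[y k n / 2 ^ k, (y k n + 1) / 2 ^ k]\<close> for \<open>n < 2 ^ s k\<close>;
  the values of \<open>y k\<close> beyond that range are irrelevant.\<close>

locale dyadic_tree =
  fixes s :: "nat \<Rightarrow> nat" and y :: "nat \<Rightarrow> nat \<Rightarrow> nat"
  assumes s_0: "s 0 = 0" and y_0: "y 0 0 = 0"
    and step: "\<And>k. s (Suc k) = Suc (s k) \<and> (\<forall>n. y (Suc k) n = 2 * y k (n div 2) + n mod 2) \<or>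
                   s (Suc k) = s k \<and> (\<forall>n. y (Suc k) n \<in> {2 * y k n, 2 * y k n + 1})"
begin

definition cell :: "nat \<Rightarrow> real \<Rightarrow> nat" where
  "cell k u = nat \<lfloor>2 ^ s k * u\<rfloor>"

text \<open>\<open>T\<close> maps the \<open>n\<close>-th interval of length \<open>2 ^ (- s k)\<close> of the unit interval into the \<open>n\<close>-th interval of
  level \<open>k\<close> of the tree, for every \<open>k\<close>.\<close>

definition X :: "nat \<Rightarrow> real \<Rightarrow> real" where
  "X k u = real (y k (cell k u)) / 2 ^ k"

definition T :: "real \<Rightarrow> real" where
  "T u = lim (\<lambda>k. X k u)"

definition U :: "real measure" where
  "U = restrict_space lborel {0..<1}"

definition \<mu> :: "real measure" where
  "\<mu> = distr U borel T"

section \<open>Nested intervals and the limit map\<close>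

lemma cell_eq_iff: "u \<ge> 0 \<Longrightarrow> cell k u = n \<longleftrightarrow> real n \<le> 2 ^ s k * u \<and> 2 ^ s k * u < real n + 1"
proof -
  assume "u \<ge> 0"
  hence "2 ^ s k * u \<ge> 0" by simp
  thus ?thesis unfolding cell_def by (simp add: nat_eq_iff) linarith
qed

lemma cell_less: "u \<in> {0..<1} \<Longrightarrow> cell k u < 2 ^ s k"
proof -
  assume u: "u \<in> {0..<1}"
  hence "real (cell k u) \<le> 2 ^ s k * u" using cell_eq_iff[of u k "cell k u"] by auto
  also have "\<dots> < 2 ^ s k" using u by simp
  finally have "real (cell k u) < real (2 ^ s k)" by simp
  thus ?thesis by (simp only: of_nat_less_iff)
qed

lemma cell_Suc_div:
  assumes "u \<ge> 0" "s (Suc k) = Suc (s k)"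
  shows "cell (Suc k) u div 2 = cell k u"
proof -
  define m where "m = cell (Suc k) u"
  have m: "real m \<le> 2 * (2 ^ s k * u)" "2 * (2 ^ s k * u) < real m + 1"
    using cell_eq_iff[of u "Suc k" m] assms by (auto simp: m_def)
  have "2 * (m div 2) \<le> m" "m + 1 \<le> 2 * (m div 2) + 2" by linarith+
  hence "2 * real (m div 2) \<le> real m" "real m + 1 \<le> 2 * real (m div 2) + 2" by linarith+
  with m have "cell k u = m div 2"
    using assms by (subst cell_eq_iff) auto
  thus ?thesis by (simp add: m_def)
qed

text \<open>Both kinds of level look alike from a single point \<open>u\<close>: its interval passes
  to one of its halves. This removes the case distinction from all that follows about
  \<open>X\<close> and \<open>T\<close>.\<close>

lemma y_cell_Suc:
  assumes "u \<ge> 0"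
  shows "y (Suc k) (cell (Suc k) u) \<in> {2 * y k (cell k u), 2 * y k (cell k u) + 1}"
  using step[of k]
proof
  assume "s (Suc k) = Suc (s k) \<and> (\<forall>n. y (Suc k) n = 2 * y k (n div 2) + n mod 2)"
  thus ?thesis using cell_Suc_div[OF assms, of k]
    by (cases "cell (Suc k) u mod 2 = 0") (auto simp: mod2_eq_if)
next
  assume *: "s (Suc k) = s k \<and> (\<forall>n. y (Suc k) n \<in> {2 * y k n, 2 * y k n + 1})"
  hence "cell (Suc k) u = cell k u" by (simp add: cell_def)
  with * show ?thesis by metis
qed

text \<open>Nestedness: left endpoints increase, and right endpoints, after adding
  \<open>1 / 2 ^ Suc k\<close>, decrease.\<close>

lemma X_Suc:
  assumes "u \<ge> 0"
  shows "X k u \<le> X (Suc k) u" "X (Suc k) u \<le> X k u + 1 / 2 ^ k - 1 / 2 ^ Suc k"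
  using y_cell_Suc[OF assms, of k] by (auto simp: X_def field_simps)

lemma X_le:
  assumes "u \<ge> 0" "k \<le> l"
  shows "X k u \<le> X l u" "X l u \<le> X k u + 1 / 2 ^ k - 1 / 2 ^ l"
proof -
  have "X k u \<le> X l u \<and> X l u \<le> X k u + 1 / 2 ^ k - 1 / 2 ^ l"
    using assms(2)
  proof (induction l rule: dec_induct)
    case (step l)
    thus ?case using X_Suc[OF assms(1), of l] by linarith
  qed simp
  thus "X k u \<le> X l u" "X l u \<le> X k u + 1 / 2 ^ k - 1 / 2 ^ l" by auto
qed

lemma X_tendsto:
  assumes "u \<ge> 0"
  shows "(\<lambda>k. X k u) \<longlonglongrightarrow> T u"
proof -
  have "incseq (\<lambda>k. X k u)" using X_le[OF assms] by (auto simp: incseq_def)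
  moreover have "X k u \<le> X 0 u + 1" for k
  proof -
    have "0 \<le> 1 / (2::real) ^ k" by simp
    moreover have "X k u \<le> X 0 u + 1 - 1 / 2 ^ k" using X_le(2)[OF assms, of 0 k] by simp
    ultimately show ?thesis by linarith
  qed
  ultimately have "convergent (\<lambda>k. X k u)"
    using incseq_convergent[of "\<lambda>k. X k u" "X 0 u + 1"] by (metis convergentI)
  thus ?thesis by (simp add: T_def convergent_LIMSEQ_iff)
qed

lemma T_bounds:
  assumes "u \<ge> 0"
  shows "X k u \<le> T u" "T u \<le> X k u + 1 / 2 ^ k"
proof -
  show "X k u \<le> T u"
    by (rule LIMSEQ_le_const[OF X_tendsto[OF assms]]) (use X_le(1)[OF assms] in blast)
  have "X l u \<le> X k u + 1 / 2 ^ k" if "l \<ge> k" for l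
  proof -
    have "0 \<le> 1 / (2::real) ^ l" by simp
    thus ?thesis using X_le(2)[OF assms that] by linarith
  qed
  thus "T u \<le> X k u + 1 / 2 ^ k"
    by (intro LIMSEQ_le_const2[OF X_tendsto[OF assms]]) blast
qed

lemma T_in_unit: "u \<in> {0..<1} \<Longrightarrow> T u \<in> {0..1}"
  using T_bounds[of u 0] cell_less[of u 0] by (simp add: X_def s_0 y_0)

text \<open>Halving recovers the parent, and at a two-child level the parity recovers the child.
  Injectivity lets the upper mass bound count intervals by their positions.\<close>

lemma y_inj: "n < 2 ^ s k \<Longrightarrow> m < 2 ^ s k \<Longrightarrow> y k n = y k m \<Longrightarrow> n = m"
proof (induction k arbitrary: n m)
  case 0
  thus ?case by (simp add: s_0)
next
  case (Suc k)
  from step[of k] show ?case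
  proof
    assume *: "s (Suc k) = Suc (s k) \<and> (\<forall>n. y (Suc k) n = 2 * y k (n div 2) + n mod 2)"
    hence eq: "2 * y k (n div 2) + n mod 2 = 2 * y k (m div 2) + m mod 2"
      using Suc.prems by metis
    hence "y k (n div 2) = y k (m div 2)" "n mod 2 = m mod 2" by presburger+
    moreover have "n div 2 < 2 ^ s k" "m div 2 < 2 ^ s k" using Suc.prems * by auto
    ultimately have "n div 2 = m div 2" using Suc.IH by blast
    with \<open>n mod 2 = m mod 2\<close> show ?thesis by (metis div_mult_mod_eq)
  next
    assume *: "s (Suc k) = s k \<and> (\<forall>n. y (Suc k) n \<in> {2 * y k n, 2 * y k n + 1})"
    hence "y k n = y k m" using Suc.prems(3)
      by (metis (no_types, lifting) Suc_eq_plus1 double_not_eq_Suc_double empty_iff insert_iff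
            mult_cancel1 nat.inject zero_neq_numeral)
    thus ?thesis using Suc * by simp
  qed
qed

section \<open>Measurability and the mass of the intervals\<close>

lemma measurable_cell [measurable]: "cell k \<in> borel \<rightarrow>\<^sub>M count_space UNIV"
  unfolding cell_def by measurable

lemma measurable_X [measurable]: "X k \<in> borel_measurable borel"
  unfolding X_def by measurable

lemma measurable_T [measurable]: "T \<in> borel_measurable borel"
  unfolding T_def by measurable

lemma space_U [simp]: "space U = {0..<1}"
  by (simp add: U_def)

lemma measurable_U [measurable (raw)]: "f \<in> borel \<rightarrow>\<^sub>M M \<Longrightarrow> f \<in> U \<rightarrow>\<^sub>M M"
  by (simp add: U_def measurable_restrict_space1)

lemma prob_space_U: "prob_space U"
  unfolding U_def by (rule prob_space_restrict_space) auto

sublocale U: prob_space U by (rule prob_space_U)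

lemma prob_space_\<mu>: "prob_space \<mu>"
  unfolding \<mu>_def by (rule U.prob_space_distr) measurable

lemma sets_\<mu> [simp]: "sets \<mu> = sets borel"
  by (simp add: \<mu>_def)

lemma measure_\<mu>: "A \<in> sets borel \<Longrightarrow> measure \<mu> A = measure U (T -` A \<inter> {0..<1})"
  unfolding \<mu>_def by (subst measure_distr) auto

definition piece :: "nat \<Rightarrow> nat \<Rightarrow> real set" where
  "piece k n = {u \<in> {0..<1}. cell k u = n}"

lemma sets_piece [measurable]: "piece k n \<in> sets U"
proof -
  have "piece k n = cell k -` {n} \<inter> space U" by (auto simp: piece_def)
  thus ?thesis using measurable_sets[OF measurable_U[OF measurable_cell[of k]], of "{n}"] by simp
qed

lemma piece_Int: "piece k n \<inter> {0..<1} = piece k n"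
  by (auto simp: piece_def)

lemma measure_piece:
  assumes "n < 2 ^ s k"
  shows "measure U (piece k n) = 1 / 2 ^ s k"
proof -
  have n: "real n + 1 \<le> 2 ^ s k"
  proof -
    have "real (Suc n) \<le> real (2 ^ s k)" using assms by (subst of_nat_le_iff) simp
    thus ?thesis by simp
  qed
  have "piece k n = {real n / 2 ^ s k ..< (real n + 1) / 2 ^ s k}"
  proof (intro set_eqI iffI)
    fix u assume "u \<in> piece k n"
    thus "u \<in> {real n / 2 ^ s k ..< (real n + 1) / 2 ^ s k}"
      using cell_eq_iff[of u k n] by (auto simp: piece_def field_simps)
  next
    fix u assume u: "u \<in> {real n / 2 ^ s k ..< (real n + 1) / 2 ^ s k}"
    have "0 \<le> real n / 2 ^ s k" by simp
    also have "\<dots> \<le> u" using u by simp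
    finally have u0: "u \<ge> 0" .
    have "u < (real n + 1) / 2 ^ s k" using u by simp
    also have "\<dots> \<le> 1" using n by simp
    finally show "u \<in> piece k n"
      using u u0 cell_eq_iff[of u k n] by (auto simp: piece_def field_simps)
  qed
  moreover have "measure U (piece k n) = measure lborel (piece k n)"
    unfolding U_def by (rule measure_restrict_space) (auto simp: piece_def)
  ultimately show ?thesis by (simp add: divide_right_mono field_simps)
qed

lemma integral_cell:
  fixes f :: "nat \<Rightarrow> complex"
  shows "(\<integral>u. f (cell k u) \<partial>U) = (\<Sum>n<2 ^ s k. f n) / 2 ^ s k"
proof -
  have "(\<integral>u. f (cell k u) \<partial>U) = (\<integral>u. (\<Sum>n<2 ^ s k. indicat_real (piece k n) u *\<^sub>R f n) \<partial>U)"
  proof (rule Bochner_Integration.integral_cong)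
    fix u assume "u \<in> space U"
    hence u: "u \<in> {0..<1}" by simp
    have "(\<Sum>n<2 ^ s k. indicat_real (piece k n) u *\<^sub>R f n) = (\<Sum>n<2 ^ s k. if n = cell k u then f n else 0)"
      using u by (intro sum.cong) (auto simp: piece_def indicator_def)
    thus "f (cell k u) = (\<Sum>n<2 ^ s k. indicat_real (piece k n) u *\<^sub>R f n)"
      using cell_less[OF u] by simp
  qed simp
  also have "\<dots> = (\<Sum>n<2 ^ s k. measure U (piece k n) *\<^sub>R f n)"
    by (subst Bochner_Integration.integral_sum)
       (auto intro!: integrable_scaleR_left simp: U.emeasure_eq_measure piece_Int)
  also have "\<dots> = (\<Sum>n<2 ^ s k. f n / 2 ^ s k)"
    by (intro sum.cong) (auto simp: measure_piece scaleR_conv_of_real)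
  finally show ?thesis by (simp add: sum_divide_distrib)
qed

text \<open>A set of diameter at most \<open>1 / 2 ^ k\<close> meets at most three intervals of
  level \<open>k\<close>, each carried by a piece of measure \<open>1 / 2 ^ s k\<close>.\<close>

lemma measure_\<mu>_upper:
  assumes I: "I \<in> sets borel" "\<And>x. x \<in> I \<Longrightarrow> p \<le> x \<and> x \<le> q" and "q - p \<le> 1 / 2 ^ k"
  shows "measure \<mu> I \<le> 3 / 2 ^ s k"
proof -
  \<comment> \<open>An interval at position \<open>i\<close> that meets \<open>I\<close> has
    \<open>i\<close> between \<open>p * 2 ^ k - 1\<close> and \<open>p * 2 ^ k + 1\<close>, a range
    with at most three integers. Clipping at 0 by \<open>nat\<close> is harmless, as positions are
    natural numbers.\<close>
  define a where "a = nat \<lceil>p * 2 ^ k - 1\<rceil>"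
  define N where "N = {n. n < 2 ^ s k \<and> y k n \<in> {a..a + 2}}"
  have fin: "finite N" by (simp add: N_def)
  have "card N \<le> card {a..a + 2}"
    by (rule card_inj_on_le[of "y k"]) (auto simp: N_def inj_on_def intro: y_inj)
  hence card: "card N \<le> 3" by simp
  have "T -` I \<inter> {0..<1} \<subseteq> (\<Union>n\<in>N. piece k n)"
  proof
    fix u assume "u \<in> T -` I \<inter> {0..<1}"
    hence u: "u \<in> {0..<1}" and Tu: "p \<le> T u" "T u \<le> q" using I by auto
    define i where "i = y k (cell k u)"
    have "p - 1 / 2 ^ k \<le> i / 2 ^ k" "i / 2 ^ k \<le> p + 1 / 2 ^ k"
      using T_bounds[of u k] u Tu assms(3) by (auto simp: X_def i_def)
    hence "p * 2 ^ k - 1 \<le> real i" "real i \<le> p * 2 ^ k + 1"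
      using mult_right_mono[of "p - 1 / 2 ^ k" "i / 2 ^ k" "2 ^ k"]
        mult_right_mono[of "i / 2 ^ k" "p + 1 / 2 ^ k" "2 ^ k"] by (simp_all add: algebra_simps)
    hence "i \<in> {a..a + 2}" unfolding a_def by simp linarith
    hence "cell k u \<in> N" using cell_less[OF u] by (simp add: N_def i_def)
    thus "u \<in> (\<Union>n\<in>N. piece k n)" using u by (auto simp: piece_def)
  qed
  hence "measure \<mu> I \<le> measure U (\<Union>n\<in>N. piece k n)"
    unfolding measure_\<mu>[OF I(1)] using fin by (intro U.finite_measure_mono) auto
  also have "\<dots> \<le> (\<Sum>n\<in>N. measure U (piece k n))"
    using fin by (intro U.finite_measure_subadditive_finite) auto
  also have "\<dots> = (\<Sum>n\<in>N. 1 / 2 ^ s k)"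
    by (intro sum.cong) (auto simp: N_def measure_piece)
  also have "\<dots> \<le> 3 / 2 ^ s k"
    using card by (auto intro!: divide_right_mono)
  finally show ?thesis .
qed

text \<open>Some \<open>T u\<close> lies within \<open>r / 2\<close> of \<open>x\<close>, and all
  points with the same cell as \<open>u\<close> have images within \<open>1 / 2 ^ k\<close>, hence
  within another \<open>r / 2\<close>, of \<open>T u\<close>. So a whole piece is mapped into
  \<open>I\<close>.\<close>

lemma measure_\<mu>_lower:
  assumes "x \<in> closure (T ` {0..<1})" "r > 0" "1 / 2 ^ k \<le> r / 2"
    and I: "I \<in> sets borel" "{x - r<..<x + r} \<subseteq> I"
  shows "1 / 2 ^ s k \<le> measure \<mu> I"
proof -
  obtain u where u: "u \<in> {0..<1}" "\<bar>T u - x\<bar> < r / 2"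
    using assms(1,2) unfolding closure_approachable dist_real_def
    by (metis (no_types, lifting) half_gt_zero imageE)
  have "piece k (cell k u) \<subseteq> T -` I \<inter> {0..<1}"
  proof
    fix v assume "v \<in> piece k (cell k u)"
    hence v: "v \<in> {0..<1}" "cell k v = cell k u" by (auto simp: piece_def)
    have "\<bar>T v - T u\<bar> \<le> 1 / 2 ^ k"
      using T_bounds[of u k] T_bounds[of v k] u v by (auto simp: X_def)
    hence "T v \<in> {x - r<..<x + r}" using u assms(3)
      unfolding greaterThanLessThan_iff by linarith
    thus "v \<in> T -` I \<inter> {0..<1}" using v I by auto
  qed
  moreover have "T -` I \<inter> {0..<1} \<in> sets U"
    using measurable_sets[OF measurable_U[OF measurable_T] I(1)] by simp
  ultimately have "measure U (piece k (cell k u)) \<le> measure \<mu> I"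
    unfolding measure_\<mu>[OF I(1)] by (intro U.finite_measure_mono) auto
  thus ?thesis using measure_piece[OF cell_less[OF u(1)]] by simp
qed

lemma compact_support: "compact (closure (T ` {0..<1}))"
proof -
  have "bounded (T ` {0..<1})"
    by (rule bounded_subset[of "{0..1}"]) (use T_in_unit in auto)
  thus ?thesis by (simp add: compact_closure)
qed

lemma measure_support: "measure \<mu> (closure (T ` {0..<1})) = 1"
proof -
  have "T -` closure (T ` {0..<1}) \<inter> {0..<1} = {0..<1}"
    using closure_subset[of "T ` {0..<1}"] by auto
  thus ?thesis using U.prob_space by (simp add: measure_\<mu>)
qed

end

section \<open>Its Fourier transform\<close>

lemma cmod_one_minus_cis_le: "cmod (1 - cis t) \<le> \<bar>t\<bar>"
  using iexp_approx1[of t 0] by (simp add: cis_conv_exp norm_minus_commute)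

lemma cmod_cis_diff_le: "cmod (cis a - cis b) \<le> \<bar>a - b\<bar>"
proof -
  have "cis a - cis b = - (cis b * (1 - cis (a - b)))" by (simp add: algebra_simps cis_mult)
  thus ?thesis using cmod_one_minus_cis_le[of "a - b"] by (simp add: norm_mult)
qed

lemma measurable_cis [measurable (raw)]:
  "f \<in> borel_measurable M \<Longrightarrow> (\<lambda>u. cis (f u)) \<in> borel_measurable M"
  unfolding cis_conv_exp by measurable

lemma sum_lessThan_double:
  fixes f :: "nat \<Rightarrow> 'a::comm_monoid_add"
  shows "(\<Sum>n<2 * N. f n) = (\<Sum>m<N. f (2 * m) + f (2 * m + 1))"
  by (induction N) (simp_all add: add_ac)

text \<open>For \<open>t > 0\<close>, \<open>\<eta> t\<close> is the integral of \<open>cis (- t x)\<close> over the unit interval; \<open>\<eta> 0\<close> is the junk value \<open>0\<close>.\<close>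

definition \<eta> :: "real \<Rightarrow> complex" where
  "\<eta> t = (1 - cis (- t)) / (\<i> * of_real t)"

lemma \<eta>_le_1: "t > 0 \<Longrightarrow> cmod (\<eta> t) \<le> 1"
  using cmod_one_minus_cis_le[of "-t"] by (simp add: \<eta>_def norm_divide norm_mult divide_le_eq)

lemma \<eta>_le: "t > 0 \<Longrightarrow> cmod (\<eta> t) \<le> 2 / t"
  using norm_triangle_ineq4[of 1 "cis (-t)"]
  by (simp add: \<eta>_def norm_divide norm_mult divide_right_mono)

text \<open>This is 1 - z^2 = (1 - z)(1 + z); it expresses that the uniform law on an interval is
  the average of the uniform laws on its halves.\<close>

lemma \<eta>_double: "\<eta> (2 * t) = \<eta> t * ((1 + cis (- t)) / 2)"
proof -
  have "1 - cis (- (2 * t)) = (1 - cis (- t)) * (1 + cis (- t))"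
    by (simp add: algebra_simps cis_mult)
  thus ?thesis by (simp add: \<eta>_def)
qed

lemma \<eta>_minus_1_le:
  assumes "t > 0"
  shows "cmod (\<eta> t - 1) \<le> t / 2"
proof -
  have "\<eta> t - 1 = - (cis (- t) - (1 + \<i> * of_real (- t))) / (\<i> * of_real t)"
    using assms by (simp add: \<eta>_def field_simps)
  also have "cmod \<dots> = cmod (cis (- t) - (1 + \<i> * of_real (- t))) / t"
    using assms by (simp add: norm_divide norm_mult norm_minus_commute)
  also have "\<dots> \<le> (t\<^sup>2 / 2) / t"
    using iexp_approx1[of "- t" 1] assms
    by (intro divide_right_mono) (simp_all add: cis_conv_exp eval_nat_numeral)
  finally show ?thesis using assms by (simp add: power2_eq_square)
qed

section \<open>Transforms of the finite levels and their limit\<close>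

context dyadic_tree
begin

definition \<phi> :: "nat \<Rightarrow> real \<Rightarrow> complex" where
  "\<phi> k \<xi> = (\<Sum>n<2 ^ s k. cis (- (2 * pi * \<xi> * (real (y k n) / 2 ^ k)))) / 2 ^ s k"

text \<open>\<open>\<phi> k\<close> belongs to equal point masses at the left endpoints of the intervals of level \<open>k\<close>, \<open>\<psi> k\<close> to the
  uniform distribution on these intervals. Only the latter decays for \<open>\<xi>\<close> much larger than \<open>2 ^ k\<close>.\<close>

definition \<psi> :: "nat \<Rightarrow> real \<Rightarrow> complex" where
  "\<psi> k \<xi> = \<phi> k \<xi> * \<eta> (2 * pi * \<xi> / 2 ^ k)"

lemma \<phi>_integral: "\<phi> k \<xi> = (\<integral>u. cis (- (2 * pi * \<xi> * X k u)) \<partial>U)"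
  using integral_cell[of "\<lambda>n. cis (- (2 * pi * \<xi> * (real (y k n) / 2 ^ k)))" k]
  by (simp add: \<phi>_def X_def)

lemma fourier_measure_\<mu>: "fourier_measure \<mu> \<xi> = (\<integral>u. cis (- (2 * pi * \<xi> * T u)) \<partial>U)"
proof -
  have "fourier_measure \<mu> \<xi> = (\<integral>x. cis (- (2 * pi * \<xi> * x)) \<partial>\<mu>)"
    by (simp add: fourier_measure_def cis_conv_exp mult_ac)
  also have "\<dots> = (\<integral>u. cis (- (2 * pi * \<xi> * T u)) \<partial>U)"
    unfolding \<mu>_def by (rule integral_distr) measurable
  finally show ?thesis .
qed

lemma integrable_cis_U: "f \<in> borel_measurable borel \<Longrightarrow> integrable U (\<lambda>u. cis (- (2 * pi * \<xi> * f u)))"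
  by (rule U.integrable_const_bound[of _ 1]) auto

lemma cmod_\<phi>_le_1: "cmod (\<phi> k \<xi>) \<le> 1"
proof -
  have "cmod (\<Sum>n<2 ^ s k. cis (- (2 * pi * \<xi> * (real (y k n) / 2 ^ k)))) \<le> (\<Sum>n<(2::nat) ^ s k. 1::real)"
    by (rule order_trans[OF norm_sum]) simp
  thus ?thesis by (simp add: \<phi>_def norm_divide norm_power)
qed

lemma cmod_fourier_le_1: "cmod (fourier_measure \<mu> \<xi>) \<le> 1"
proof -
  have "cmod (fourier_measure \<mu> \<xi>) \<le> (\<integral>u. cmod (cis (- (2 * pi * \<xi> * T u))) \<partial>U)"
    unfolding fourier_measure_\<mu> by (rule integral_norm_bound)
  thus ?thesis using U.prob_space by simp
qed

text \<open>The integrands differ by at most the difference of their phases, and \<open>T\<close>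
  takes values in the unit interval.\<close>

lemma fourier_lipschitz:
  "cmod (fourier_measure \<mu> \<xi> - fourier_measure \<mu> \<zeta>) \<le> 2 * pi * \<bar>\<xi> - \<zeta>\<bar>"
proof -
  have "fourier_measure \<mu> \<xi> - fourier_measure \<mu> \<zeta> =
      (\<integral>u. cis (- (2 * pi * \<xi> * T u)) - cis (- (2 * pi * \<zeta> * T u)) \<partial>U)"
    unfolding fourier_measure_\<mu>
    by (rule Bochner_Integration.integral_diff[symmetric]) (auto intro!: integrable_cis_U)
  also have "cmod \<dots> \<le> (\<integral>u. cmod (cis (- (2 * pi * \<xi> * T u)) - cis (- (2 * pi * \<zeta> * T u))) \<partial>U)"
    by (rule integral_norm_bound)
  also have "\<dots> \<le> (\<integral>u. 2 * pi * \<bar>\<xi> - \<zeta>\<bar> \<partial>U)"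
  proof (rule integral_mono)
    fix u assume "u \<in> space U"
    hence u: "\<bar>T u\<bar> \<le> 1" using T_in_unit[of u] by auto
    have "cmod (cis (- (2 * pi * \<xi> * T u)) - cis (- (2 * pi * \<zeta> * T u)))
        \<le> \<bar>- (2 * pi * \<xi> * T u) - - (2 * pi * \<zeta> * T u)\<bar>" by (rule cmod_cis_diff_le)
    also have "\<dots> = \<bar>2 * pi * (\<zeta> - \<xi>) * T u\<bar>" by (simp add: algebra_simps)
    also have "\<dots> = 2 * pi * \<bar>\<xi> - \<zeta>\<bar> * \<bar>T u\<bar>" by (simp add: abs_mult abs_minus_commute)
    also have "\<dots> \<le> 2 * pi * \<bar>\<xi> - \<zeta>\<bar>" using u by (intro mult_left_le) auto
    finally show "cmod (cis (- (2 * pi * \<xi> * T u)) - cis (- (2 * pi * \<zeta> * T u)))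
        \<le> 2 * pi * \<bar>\<xi> - \<zeta>\<bar>" .
  qed (auto intro!: integrable_norm Bochner_Integration.integrable_diff integrable_cis_U)
  finally show ?thesis using U.prob_space by simp
qed

lemma fourier_minus: "fourier_measure \<mu> (- \<xi>) = cnj (fourier_measure \<mu> \<xi>)"
  unfolding fourier_measure_\<mu> Bochner_Integration.integral_cnj[symmetric]
  by (simp only: cis_cnj minus_minus mult_minus_left mult_minus_right)

lemma \<phi>_tendsto: "(\<lambda>k. \<phi> k \<xi>) \<longlonglongrightarrow> fourier_measure \<mu> \<xi>"
  unfolding \<phi>_integral fourier_measure_\<mu>
proof (rule integral_dominated_convergence[where w = "\<lambda>_. 1"])
  show "AE u in U. (\<lambda>k. cis (- (2 * pi * \<xi> * X k u))) \<longlonglongrightarrow> cis (- (2 * pi * \<xi> * T u))"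
    by (intro AE_I2 tendsto_intros X_tendsto) auto
qed auto

text \<open>The point-mass transforms converge by dominated convergence, and the smoothing factor
  \<open>\<eta>\<close> tends to 1.\<close>

lemma \<psi>_tendsto:
  assumes "\<xi> > 0"
  shows "(\<lambda>k. \<psi> k \<xi>) \<longlonglongrightarrow> fourier_measure \<mu> \<xi>"
proof -
  have "(\<lambda>k. \<eta> (2 * pi * \<xi> / 2 ^ k) - 1) \<longlonglongrightarrow> 0"
  proof (rule Lim_null_comparison)
    show "\<forall>\<^sub>F k in sequentially. cmod (\<eta> (2 * pi * \<xi> / 2 ^ k) - 1) \<le> (2 * pi * \<xi> / 2 ^ k) / 2"
      using assms by (intro always_eventually allI \<eta>_minus_1_le) simp
    show "(\<lambda>k. (2 * pi * \<xi> / 2 ^ k) / 2) \<longlonglongrightarrow> 0" by real_asymp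
  qed
  hence "(\<lambda>k. \<eta> (2 * pi * \<xi> / 2 ^ k)) \<longlonglongrightarrow> 1" by (simp add: LIM_zero_iff)
  from tendsto_mult[OF \<phi>_tendsto this] show ?thesis by (simp add: \<psi>_def)
qed

text \<open>Keeping both halves of every interval leaves the uniform distribution unchanged.\<close>

lemma \<psi>_Suc_split:
  assumes "s (Suc k) = Suc (s k)"
  shows "\<psi> (Suc k) \<xi> = \<psi> k \<xi>"
proof -
  define t where "t = 2 * pi * \<xi> / 2 ^ Suc k"
  have y: "y (Suc k) n = 2 * y k (n div 2) + n mod 2" for n
    using step[of k] assms by auto
  have "(\<Sum>n<2 ^ s (Suc k). cis (- (2 * pi * \<xi> * (real (y (Suc k) n) / 2 ^ Suc k)))) =
      (\<Sum>m<2 ^ s k. cis (- (2 * pi * \<xi> * (real (y k m) / 2 ^ k))) * (1 + cis (- t)))"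
    unfolding assms power_Suc sum_lessThan_double
  proof (intro sum.cong refl)
    fix m :: nat
    have odd: "(2 * m + 1) mod 2 = 1" "(2 * m + 1) div 2 = m" by presburger+
    show "cis (- (2 * pi * \<xi> * (real (y (Suc k) (2 * m)) / (2 * 2 ^ k)))) +
        cis (- (2 * pi * \<xi> * (real (y (Suc k) (2 * m + 1)) / (2 * 2 ^ k)))) =
        cis (- (2 * pi * \<xi> * (real (y k m) / 2 ^ k))) * (1 + cis (- t))"
      unfolding y odd distrib_left cis_mult
      by (simp add: t_def algebra_simps add_divide_distrib)
  qed
  hence "\<phi> (Suc k) \<xi> = \<phi> k \<xi> * ((1 + cis (- t)) / 2)"
    by (simp add: \<phi>_def assms sum_distrib_right[symmetric])
  moreover have "2 * pi * \<xi> / 2 ^ k = 2 * t" by (simp add: t_def)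
  ultimately show ?thesis
    unfolding \<psi>_def by (simp only: \<eta>_double flip: t_def) simp
qed

text \<open>The phase of the chosen half is the mean of the phases of both halves plus or minus half
  their difference. By \<open>\<eta>_double\<close> the mean part reproduces
  \<open>\<psi> k\<close>, so only the signed sum remains.\<close>

lemma \<psi>_Suc_diff:
  assumes "s (Suc k) = s k"
  shows "\<psi> (Suc k) \<xi> - \<psi> k \<xi> =
    \<eta> (2 * pi * \<xi> / 2 ^ Suc k) * ((cis (- (2 * pi * \<xi> / 2 ^ Suc k)) - 1) / 2) *
    ((\<Sum>n<2 ^ s k. of_real (2 * (real (y (Suc k) n) - 2 * real (y k n)) - 1) *
         cis (- (2 * pi * \<xi> * (real (y k n) / 2 ^ k)))) / 2 ^ s k)"
proof -
  define t where "t = 2 * pi * \<xi> / 2 ^ Suc k"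
  define e where "e = (\<lambda>n. cis (- (2 * pi * \<xi> * (real (y k n) / 2 ^ k))))"
  define b where "b = (\<lambda>n. real (y (Suc k) n) - 2 * real (y k n))"
  have b: "b n = 0 \<or> b n = 1" for n
  proof -
    have "y (Suc k) n \<in> {2 * y k n, 2 * y k n + 1}" using step[of k] assms by auto
    thus ?thesis by (auto simp: b_def)
  qed
  have ee: "cis (- (2 * pi * \<xi> * (real (y (Suc k) n) / 2 ^ Suc k))) =
      e n * ((1 + cis (- t)) / 2) + of_real (2 * b n - 1) * e n * ((cis (- t) - 1) / 2)" for n
  proof -
    have "real (y (Suc k) n) = 2 * real (y k n) + b n" by (simp add: b_def)
    hence "cis (- (2 * pi * \<xi> * (real (y (Suc k) n) / 2 ^ Suc k))) = e n * cis (- (t * b n))"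
      by (simp add: e_def t_def cis_mult algebra_simps add_divide_distrib)
    thus ?thesis using b[of n] by (auto simp: field_simps)
  qed
  have "\<phi> (Suc k) \<xi> = (\<Sum>n<2 ^ s k. e n * ((1 + cis (- t)) / 2) +
      of_real (2 * b n - 1) * e n * ((cis (- t) - 1) / 2)) / 2 ^ s k"
    unfolding \<phi>_def assms ee ..
  also have "\<dots> = \<phi> k \<xi> * ((1 + cis (- t)) / 2) +
      (\<Sum>n<2 ^ s k. of_real (2 * b n - 1) * e n) / 2 ^ s k * ((cis (- t) - 1) / 2)"
    unfolding \<phi>_def e_def[symmetric] sum.distrib sum_distrib_right[symmetric]
    by (simp add: add_divide_distrib)
  finally have "\<psi> (Suc k) \<xi> = \<eta> t * (\<phi> k \<xi> * ((1 + cis (- t)) / 2) +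
      (\<Sum>n<2 ^ s k. of_real (2 * b n - 1) * e n) / 2 ^ s k * ((cis (- t) - 1) / 2))"
    by (simp add: \<psi>_def t_def)
  moreover have "\<psi> k \<xi> = \<eta> t * (\<phi> k \<xi> * ((1 + cis (- t)) / 2))"
  proof -
    have "2 * pi * \<xi> / 2 ^ k = 2 * t" by (simp add: t_def)
    thus ?thesis unfolding \<psi>_def by (simp only: \<eta>_double) simp
  qed
  ultimately have "\<psi> (Suc k) \<xi> - \<psi> k \<xi> = \<eta> t * ((cis (- t) - 1) / 2) *
      ((\<Sum>n<2 ^ s k. of_real (2 * b n - 1) * e n) / 2 ^ s k)"
    by (simp add: algebra_simps)
  thus ?thesis unfolding b_def e_def t_def .
qed

end

text \<open>The real coefficient in the sum is \<open>1\<close> if the right half of the \<open>n\<close>-th interval is kept and \<open>-1\<close> otherwise.\<close>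

locale balanced_dyadic_tree = dyadic_tree +
  assumes balanced: "\<And>k j. s (Suc k) = s k \<Longrightarrow>
    cmod (\<Sum>n<2 ^ s k. of_real (2 * (real (y (Suc k) n) - 2 * real (y k n)) - 1) *
         cis (- (2 * pi * sqrt (real j) * (real (y k n) / 2 ^ k))))
      \<le> 9 * sqrt (2 ^ s k * ln (real j + 2))"
begin

text \<open>Only one-child levels contribute. There the balanced sum is bounded at the net
  frequency, where \<open>real j + 2\<close> is \<open>\<xi>\<^sup>2 + 2\<close>, while the two
  bounds on \<open>\<eta>\<close> give the minimum.\<close>

lemma \<psi>_Suc_diff_le:
  assumes "j > 0"
  defines "\<xi> \<equiv> sqrt (real j)"
  shows "cmod (\<psi> (Suc k) \<xi> - \<psi> k \<xi>) \<le> 9 * (min 1 (2 ^ k / \<xi>) * sqrt (ln (\<xi>\<^sup>2 + 2) / 2 ^ s k))"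
proof (cases "s (Suc k) = s k")
  case False
  hence "s (Suc k) = Suc (s k)" using step[of k] by auto
  thus ?thesis using assms by (simp add: \<psi>_Suc_split)
next
  case True
  define t where "t = 2 * pi * \<xi> / 2 ^ Suc k"
  define S where "S = (\<Sum>n<2 ^ s k. of_real (2 * (real (y (Suc k) n) - 2 * real (y k n)) - 1) *
         cis (- (2 * pi * \<xi> * (real (y k n) / 2 ^ k))))"
  have \<xi>: "\<xi> > 0" using assms by simp
  have t: "t > 0" using \<xi> by (simp add: t_def)
  have c: "cmod ((cis (- t) - 1) / 2) \<le> 1"
    using norm_triangle_ineq4[of "cis (-t)" 1] by (simp add: norm_divide)
  have "2 / t = 2 * 2 ^ k / (pi * \<xi>)" by (simp add: t_def)
  also have "\<dots> \<le> 2 ^ k / \<xi>"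
    using \<xi> pi_ge_two by (simp add: field_simps)
  finally have "cmod (\<eta> t) \<le> min 1 (2 ^ k / \<xi>)" using \<eta>_le_1[OF t] \<eta>_le[OF t] by linarith
  hence 1: "cmod (\<eta> t * ((cis (- t) - 1) / 2)) \<le> min 1 (2 ^ k / \<xi>) * 1"
    unfolding norm_mult using c by (intro mult_mono) (auto simp: \<xi> less_imp_le)
  have "cmod S \<le> 9 * sqrt (2 ^ s k * ln (real j + 2))"
    using balanced[OF True, of j] by (simp add: S_def \<xi>_def)
  hence "cmod (S / 2 ^ s k) \<le> 9 * sqrt (2 ^ s k * ln (real j + 2)) / 2 ^ s k"
    by (simp add: norm_divide norm_power divide_right_mono)
  also have "\<dots> = 9 * sqrt (ln (\<xi>\<^sup>2 + 2) / 2 ^ s k)"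
  proof -
    have "sqrt (2 ^ s k * L) / 2 ^ s k = sqrt (L / 2 ^ s k)" for L
    proof -
      have "sqrt (L / 2 ^ s k) = sqrt (2 ^ s k * L / (2 ^ s k)\<^sup>2)" by (simp add: power2_eq_square)
      also have "\<dots> = sqrt (2 ^ s k * L) / 2 ^ s k" by (simp only: real_sqrt_divide real_sqrt_abs) simp
      finally show ?thesis ..
    qed
    from this[of "ln (real j + 2)"] show ?thesis
      unfolding times_divide_eq_right[symmetric] by (simp add: \<xi>_def)
  qed
  finally have "cmod (\<eta> t * ((cis (- t) - 1) / 2) * (S / 2 ^ s k)) \<le>
      min 1 (2 ^ k / \<xi>) * (9 * sqrt (ln (\<xi>\<^sup>2 + 2) / 2 ^ s k))"
    using 1 \<xi> by (subst norm_mult, intro mult_mono) auto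
  thus ?thesis unfolding \<psi>_Suc_diff[OF True] S_def t_def by simp
qed

text \<open>Telescoping from level 0, where the bound on \<open>\<eta>\<close> for the unit interval
  gives \<open>1 / \<xi>\<close>.\<close>

lemma \<psi>_le_sum:
  assumes "j > 0"
  defines "\<xi> \<equiv> sqrt (real j)"
  shows "cmod (\<psi> K \<xi>) \<le> 1 / \<xi> + 9 * (\<Sum>k<K. min 1 (2 ^ k / \<xi>) * sqrt (ln (\<xi>\<^sup>2 + 2) / 2 ^ s k))"
proof (induction K)
  case 0
  have \<xi>: "\<xi> > 0" using assms by simp
  have "cmod (\<psi> 0 \<xi>) = cmod (\<phi> 0 \<xi>) * cmod (\<eta> (2 * pi * \<xi>))" by (simp add: \<psi>_def norm_mult)
  also have "\<dots> \<le> 1 * (2 / (2 * pi * \<xi>))"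
    using \<xi> by (intro mult_mono cmod_\<phi>_le_1 \<eta>_le) auto
  also have "\<dots> \<le> 1 / \<xi>" using \<xi> pi_ge_two by (simp add: field_simps)
  finally show ?case by simp
next
  case (Suc K)
  have "cmod (\<psi> (Suc K) \<xi>) \<le> cmod (\<psi> K \<xi>) + cmod (\<psi> (Suc K) \<xi> - \<psi> K \<xi>)"
    using norm_triangle_ineq[of "\<psi> K \<xi>" "\<psi> (Suc K) \<xi> - \<psi> K \<xi>"] by simp
  also note add_mono[OF Suc.IH \<psi>_Suc_diff_le[OF assms(1), of K, folded \<xi>_def]]
  finally show ?case by (simp add: algebra_simps)
qed

end

section \<open>Summing the increments\<close>

text \<open>The distance to \<open>m\<close> is injective on each side of \<open>m\<close>, so each
  side is at most the sum of (i + 1) q^i, the derivative of the geometric series.\<close>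

lemma sum_power_series_around:
  fixes q :: real
  assumes "0 \<le> q" "q < 1"
  shows "(\<Sum>k<K. real (nat \<bar>int k - int m\<bar> + 1) * q ^ nat \<bar>int k - int m\<bar>) \<le> 2 / (1 - q)\<^sup>2"
proof -
  define h where "h = (\<lambda>i. real (Suc i) * q ^ i)"
  have h: "h sums (1 / (1 - q)\<^sup>2)"
    unfolding h_def using geometric_deriv_sums[of q] assms by simp
  define d where "d = (\<lambda>k. nat \<bar>int k - int m\<bar>)"
  have *: "(\<Sum>k\<in>A. h (d k)) \<le> 1 / (1 - q)\<^sup>2" if "finite A" "inj_on d A" for A
  proof -
    have "(\<Sum>k\<in>A. h (d k)) = (\<Sum>i\<in>d ` A. h i)"
      using that by (simp add: sum.reindex)
    also have "\<dots> \<le> suminf h"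
      using that assms by (intro sum_le_suminf sums_summable[OF h]) (auto simp: h_def)
    finally show ?thesis using sums_unique[OF h] by simp
  qed
  have "(\<Sum>k<K. h (d k)) = (\<Sum>k\<in>{..<K} \<inter> {..<m}. h (d k)) + (\<Sum>k\<in>{..<K} - {..<m}. h (d k))"
    by (rule sum.Int_Diff) simp
  also have "\<dots> \<le> 1 / (1 - q)\<^sup>2 + 1 / (1 - q)\<^sup>2"
    by (intro add_mono *) (auto simp: inj_on_def d_def)
  finally show ?thesis by (simp add: h_def d_def)
qed

text \<open>Choose \<open>m\<close> with \<open>\<xi>\<close> between \<open>2 ^ m\<close> and
  \<open>2 ^ Suc m\<close>. With i the distance from \<open>k\<close> to \<open>m\<close>, the
  \<open>k\<close>-th term is at most \<open>2 * q ^ m\<close> times (i + 1) q^i: the logarithm is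
  of order m + 1, and its ratio to k + 1 grows only polynomially in i.\<close>

lemma decay_series_bound:
  fixes \<alpha> :: real
  assumes "0 < \<alpha>" "\<alpha> < 1"
  obtains D where "D > 0"
    "\<And>K \<xi>. \<xi> \<ge> 1 \<Longrightarrow>
       (\<Sum>k<K. min 1 (2 ^ k / \<xi>) * sqrt (ln (\<xi>\<^sup>2 + 2) / (2 powr (\<alpha> * k) * (real k + 1))))
         \<le> D * \<xi> powr (- \<alpha> / 2)"
proof -
  define q :: real where "q = 2 powr (- \<alpha> / 2)"
  have q: "0 < q" "q < 1" using assms by (auto simp: q_def powr_less_one)
  \<comment> \<open>Here \<open>\<alpha> < 1\<close> enters: below \<open>m\<close> the gain 2^(-i)
    from \<open>2 ^ k / \<xi>\<close> beats the growth of \<open>q ^ k\<close>.\<close>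
  have q2: "1 / 2 \<le> q * q"
  proof -
    have "(2::real) powr (-1) \<le> 2 powr (- \<alpha>)" using assms by (intro powr_mono) auto
    thus ?thesis by (simp add: q_def powr_minus_divide flip: powr_add)
  qed
  \<comment> \<open>The factor \<open>q\<close> in the denominator pays for passing from
    \<open>q ^ m\<close> to \<open>q ^ Suc m\<close>, which is the power of \<open>2 ^ Suc m\<close>
    comparable with \<open>\<xi> powr (- \<alpha> / 2)\<close>.\<close>
  define D where "D = 4 / (q * (1 - q)\<^sup>2)"
  have "(\<Sum>k<K. min 1 (2 ^ k / \<xi>) * sqrt (ln (\<xi>\<^sup>2 + 2) / (2 powr (\<alpha> * k) * (real k + 1))))
         \<le> D * \<xi> powr (- \<alpha> / 2)" if \<xi>: "\<xi> \<ge> 1" for K \<xi>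
  proof -
    define m where "m = nat \<lfloor>log 2 \<xi>\<rfloor>"
    have "\<lfloor>log 2 \<xi>\<rfloor> \<ge> 0" using \<xi> by simp
    hence m': "real m \<le> log 2 \<xi>" "log 2 \<xi> < real (Suc m)"
      unfolding m_def by linarith+
    have m: "2 ^ m \<le> \<xi>" "\<xi> < 2 ^ Suc m"
      using m' \<xi> by (simp_all add: le_log_iff log_less_iff powr_realpow del: of_nat_Suc power_Suc)
    have "\<xi>\<^sup>2 + 2 \<le> (2 ^ Suc m)\<^sup>2 + 2"
      using m \<xi> by (intro add_right_mono power_mono) auto
    also have "\<dots> \<le> (2 ^ Suc m)\<^sup>2 + (2 ^ Suc m)\<^sup>2"
    proof (intro add_left_mono)
      have "(2::real) \<le> 2 ^ Suc m" using one_le_power[of "2::real" m] by simp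
      also have "\<dots> \<le> (2 ^ Suc m)\<^sup>2" using one_le_power[of "2::real" "Suc m"]
        by (intro self_le_power) simp_all
      finally show "(2::real) \<le> (2 ^ Suc m)\<^sup>2" .
    qed
    also have "\<dots> \<le> 2 ^ (2 * m + 4)"
      by (simp add: power_add power2_eq_square power_mult flip: power_mult_distrib)
    finally have "ln (\<xi>\<^sup>2 + 2) \<le> ln (2 ^ (2 * m + 4))"
      using \<xi> by (subst ln_le_cancel_iff) (auto simp: add_pos_pos)
    also have "\<dots> = real (2 * m + 4) * ln 2" by (simp add: ln_realpow)
    also have "\<dots> \<le> real (2 * m + 4) * 1" using ln2_le_25_over_36 by (intro mult_left_mono) auto
    also have "\<dots> \<le> 4 * (real m + 1)" by simp
    finally have lnb: "ln (\<xi>\<^sup>2 + 2) \<le> 4 * (real m + 1)" .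
    have ln0: "ln (\<xi>\<^sup>2 + 2) \<ge> 0" using \<xi> by simp
    have le: "min 1 (2 ^ k / \<xi>) * sqrt (ln (\<xi>\<^sup>2 + 2) / (2 powr (\<alpha> * k) * (real k + 1)))
      \<le> 2 * q ^ m * (real (nat \<bar>int k - int m\<bar> + 1) * q ^ nat \<bar>int k - int m\<bar>)" for k
    proof -
      define i where "i = nat \<bar>int k - int m\<bar>"
      have "real m + 1 \<le> (real k + 1) * (real i + 1)"
      proof -
        have "real m + 1 \<le> real k + real i + 1" unfolding i_def by linarith
        also have "real k + real i + 1 \<le> (real k + 1) * (real i + 1)" by (simp add: algebra_simps)
        finally show ?thesis by simp
      qed
      \<comment> \<open>Squared so that the square root leaves exactly the linear weight of the
        summed series.\<close>
      also have "\<dots> \<le> (real k + 1) * (real i + 1)\<^sup>2"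
        by (intro mult_left_mono) (auto simp: power2_eq_square)
      finally have mk: "(real m + 1) / (real k + 1) \<le> (real i + 1)\<^sup>2"
        by (simp add: divide_le_eq mult.commute)
      have mk4: "4 * (real m + 1) / (real k + 1) \<le> 4 * (real i + 1)\<^sup>2"
        using mult_left_mono[OF mk, of 4] by (simp only: times_divide_eq_right)
      have qk: "2 powr (\<alpha> * k) = 1 / (q ^ k)\<^sup>2"
        by (simp add: q_def powr_minus powr_power field_simps flip: powr_add)
      have "ln (\<xi>\<^sup>2 + 2) / (2 powr (\<alpha> * k) * (real k + 1)) = (q ^ k)\<^sup>2 * (ln (\<xi>\<^sup>2 + 2) / (real k + 1))"
        using q by (simp add: qk)
      also have "\<dots> \<le> (q ^ k)\<^sup>2 * (4 * (real m + 1) / (real k + 1))"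
        by (intro mult_left_mono divide_right_mono lnb) auto
      also have "\<dots> \<le> (q ^ k)\<^sup>2 * (4 * (real i + 1)\<^sup>2)"
        by (intro mult_left_mono mk4) auto
      also have "\<dots> = (2 * (real i + 1) * q ^ k)\<^sup>2" by (simp only: power_mult_distrib) simp
      finally have "sqrt (ln (\<xi>\<^sup>2 + 2) / (2 powr (\<alpha> * k) * (real k + 1))) \<le> sqrt ((2 * (real i + 1) * q ^ k)\<^sup>2)"
        by (rule real_sqrt_le_mono)
      hence sq: "sqrt (ln (\<xi>\<^sup>2 + 2) / (2 powr (\<alpha> * k) * (real k + 1))) \<le> 2 * (real i + 1) * q ^ k"
        using q by simp
      have mq: "min 1 (2 ^ k / \<xi>) * q ^ k \<le> q ^ m * q ^ i"
      proof (cases "k \<ge> m")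
        case True
        hence "k = m + i" by (simp add: i_def)
        hence "q ^ k = q ^ m * q ^ i" by (simp add: power_add)
        thus ?thesis using q by (simp add: mult_le_cancel_right1)
      next
        case False
        hence mki: "m = k + i" by (simp add: i_def)
        have "2 ^ k / \<xi> \<le> 2 ^ k / 2 ^ m" using m \<xi> by (intro divide_left_mono) auto
        also have "\<dots> = (1 / 2) ^ i" by (simp add: mki power_add power_divide)
        also have "\<dots> \<le> (q * q) ^ i" using q2 by (intro power_mono) auto
        finally have "2 ^ k / \<xi> * q ^ k \<le> (q * q) ^ i * q ^ k"
          using q by (intro mult_right_mono) auto
        also have "\<dots> = q ^ m * q ^ i" by (simp add: mki power_add power_mult_distrib)
        finally show ?thesis
          using q by (meson min.cobounded2 mult_right_mono order_trans zero_le_power less_imp_le)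
      qed
      have "min 1 (2 ^ k / \<xi>) * sqrt (ln (\<xi>\<^sup>2 + 2) / (2 powr (\<alpha> * k) * (real k + 1)))
        \<le> min 1 (2 ^ k / \<xi>) * (2 * (real i + 1) * q ^ k)"
        using \<xi> by (intro mult_left_mono sq) auto
      also have "\<dots> = 2 * (real i + 1) * (min 1 (2 ^ k / \<xi>) * q ^ k)" by simp
      also have "\<dots> \<le> 2 * (real i + 1) * (q ^ m * q ^ i)" by (intro mult_left_mono mq) auto
      also have "\<dots> = 2 * q ^ m * (real (i + 1) * q ^ i)" by (simp only: of_nat_add of_nat_1 mult_ac)
      finally show ?thesis unfolding i_def .
    qed
    have "(\<Sum>k<K. min 1 (2 ^ k / \<xi>) * sqrt (ln (\<xi>\<^sup>2 + 2) / (2 powr (\<alpha> * k) * (real k + 1))))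
      \<le> (\<Sum>k<K. 2 * q ^ m * (real (nat \<bar>int k - int m\<bar> + 1) * q ^ nat \<bar>int k - int m\<bar>))"
      by (rule sum_mono) (rule le)
    also have "\<dots> = 2 * q ^ m * (\<Sum>k<K. real (nat \<bar>int k - int m\<bar> + 1) * q ^ nat \<bar>int k - int m\<bar>)"
      by (rule sum_distrib_left[symmetric])
    also have "\<dots> \<le> 2 * q ^ m * (2 / (1 - q)\<^sup>2)"
      using q by (intro mult_left_mono sum_power_series_around) auto
    also have "\<dots> = D * q ^ Suc m" using q by (simp add: D_def)
    also have "\<dots> \<le> D * \<xi> powr (- \<alpha> / 2)"
    proof (rule mult_left_mono)
      have "q ^ Suc m = (2 ^ Suc m) powr (- \<alpha> / 2)"
        by (simp add: q_def powr_power powr_powr mult.commute flip: powr_realpow del: power_Suc)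
      also have "\<dots> \<le> \<xi> powr (- \<alpha> / 2)"
        using m \<xi> assms by (intro powr_mono2') auto
      finally show "q ^ Suc m \<le> \<xi> powr (- \<alpha> / 2)" .
    qed (use q in \<open>simp add: D_def\<close>)
    finally show ?thesis .
  qed
  moreover have "D > 0" using q by (simp add: D_def)
  ultimately show thesis using that by blast
qed

section \<open>Construction of the measure\<close>

text \<open>At net frequencies the bound on \<open>\<psi> K\<close> is uniform in \<open>K\<close>
  and passes to the limit. The Lipschitz bound extends it to \<open>\<xi> \<ge> 1\<close>, the
  trivial bound covers smaller positive \<open>\<xi>\<close>, and conjugation covers negative
  ones.\<close>

lemma (in balanced_dyadic_tree) fourier_decay:
  assumes \<alpha>: "0 < \<alpha>" "\<alpha> < 1" and b: "b > 0"
    and growth: "\<And>k. b * (2 powr (\<alpha> * k) * (real k + 1)) \<le> 2 ^ s k"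
  obtains C where "\<And>\<xi>. \<xi> \<noteq> 0 \<Longrightarrow> cmod (fourier_measure \<mu> \<xi>) \<le> C * \<bar>\<xi>\<bar> powr (- \<alpha> / 2)"
proof -
  obtain D where D: "D > 0"
    "\<And>K \<xi>. \<xi> \<ge> 1 \<Longrightarrow>
       (\<Sum>k<K. min 1 (2 ^ k / \<xi>) * sqrt (ln (\<xi>\<^sup>2 + 2) / (2 powr (\<alpha> * k) * (real k + 1))))
         \<le> D * \<xi> powr (- \<alpha> / 2)"
    using decay_series_bound[OF \<alpha>] by blast
  define C1 where "C1 = 1 + 9 * (sqrt (1 / b) * D)"
  have C1: "C1 \<ge> 1" using D b by (simp add: C1_def)
  have inv: "1 / \<xi> \<le> \<xi> powr (- \<alpha> / 2)" if "\<xi> \<ge> 1" for \<xi> :: real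
  proof -
    have "1 / \<xi> = \<xi> powr (-1)" using that by (simp add: powr_minus_divide)
    also have "\<dots> \<le> \<xi> powr (- \<alpha> / 2)" using that \<alpha> by (intro powr_mono) auto
    finally show ?thesis .
  qed
  have net: "cmod (fourier_measure \<mu> (sqrt (real j))) \<le> C1 * sqrt (real j) powr (- \<alpha> / 2)"
    if j: "j > 0" for j
  proof -
    define \<xi> where "\<xi> = sqrt (real j)"
    have \<xi>: "\<xi> \<ge> 1" using j by (simp add: \<xi>_def)
    have "cmod (\<psi> K \<xi>) \<le> C1 * \<xi> powr (- \<alpha> / 2)" for K
    proof -
      have "sqrt (ln (\<xi>\<^sup>2 + 2) / 2 ^ s k) \<le>
          sqrt (1 / b) * sqrt (ln (\<xi>\<^sup>2 + 2) / (2 powr (\<alpha> * k) * (real k + 1)))" for k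
      proof -
        have "ln (\<xi>\<^sup>2 + 2) / 2 ^ s k \<le> ln (\<xi>\<^sup>2 + 2) / (b * (2 powr (\<alpha> * k) * (real k + 1)))"
          using growth[of k] b by (intro divide_left_mono) auto
        also have "\<dots> = (1 / b) * (ln (\<xi>\<^sup>2 + 2) / (2 powr (\<alpha> * k) * (real k + 1)))" by simp
        finally show ?thesis unfolding real_sqrt_mult[symmetric] by (rule real_sqrt_le_mono)
      qed
      hence "(\<Sum>k<K. min 1 (2 ^ k / \<xi>) * sqrt (ln (\<xi>\<^sup>2 + 2) / 2 ^ s k)) \<le>
          (\<Sum>k<K. min 1 (2 ^ k / \<xi>) *
             (sqrt (1 / b) * sqrt (ln (\<xi>\<^sup>2 + 2) / (2 powr (\<alpha> * k) * (real k + 1)))))"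
        using \<xi> by (intro sum_mono mult_left_mono) auto
      also have "\<dots> = sqrt (1 / b) * (\<Sum>k<K. min 1 (2 ^ k / \<xi>) *
             sqrt (ln (\<xi>\<^sup>2 + 2) / (2 powr (\<alpha> * k) * (real k + 1))))"
        unfolding sum_distrib_left by (intro sum.cong refl mult.left_commute)
      also have "\<dots> \<le> sqrt (1 / b) * (D * \<xi> powr (- \<alpha> / 2))"
        using b by (intro mult_left_mono D(2) \<xi>) auto
      finally have "cmod (\<psi> K \<xi>) \<le> \<xi> powr (- \<alpha> / 2) + 9 * (sqrt (1 / b) * (D * \<xi> powr (- \<alpha> / 2)))"
        using \<psi>_le_sum[OF j, of K, folded \<xi>_def] inv[OF \<xi>] by linarith
      thus ?thesis by (simp add: C1_def algebra_simps)
    qed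
    moreover have "(\<lambda>K. cmod (\<psi> K \<xi>)) \<longlonglongrightarrow> cmod (fourier_measure \<mu> \<xi>)"
      using \<xi> by (intro tendsto_norm \<psi>_tendsto) auto
    ultimately show ?thesis unfolding \<xi>_def[symmetric] by (intro LIMSEQ_le_const2) auto
  qed
  define C where "C = 2 * pi + 2 * C1"
  have C: "C \<ge> 1" using C1 pi_gt_zero unfolding C_def by linarith
  have pos: "cmod (fourier_measure \<mu> \<xi>) \<le> C * \<xi> powr (- \<alpha> / 2)" if "\<xi> > 0" for \<xi>
  proof (cases "\<xi> \<ge> 1")
    case False
    have "1 = 1 powr (- \<alpha> / 2)" by simp
    also have "\<dots> \<le> \<xi> powr (- \<alpha> / 2)" using False that \<alpha> by (intro powr_mono2') auto
    finally have p1: "1 \<le> \<xi> powr (- \<alpha> / 2)" .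
    have "1 * 1 \<le> C * \<xi> powr (- \<alpha> / 2)" using C p1 by (intro mult_mono) auto
    thus ?thesis using cmod_fourier_le_1[of \<xi>] by linarith
  next
    case True
    \<comment> \<open>With \<open>\<zeta> = sqrt j\<close> the difference of the squares is at most
      1, so \<open>\<zeta>\<close> lies within \<open>1 / \<xi>\<close> of \<open>\<xi>\<close>;
      also \<open>\<zeta>\<close> is at least \<open>\<xi> / 2\<close>, so its power is at most
      twice that of \<open>\<xi>\<close>.\<close>
    define j where "j = nat \<lfloor>\<xi>\<^sup>2\<rfloor>"
    define \<zeta> where "\<zeta> = sqrt (real j)"
    have "1 \<le> \<xi>\<^sup>2" using True by simp
    hence j: "real j \<le> \<xi>\<^sup>2" "\<xi>\<^sup>2 < real j + 1" "j \<ge> 1" unfolding j_def by linarith+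
    have \<zeta>2: "\<zeta>\<^sup>2 = real j" and \<zeta>1: "\<zeta> \<ge> 1" using j by (auto simp: \<zeta>_def)
    have \<zeta>\<xi>: "\<zeta> \<le> \<xi>" using j True by (simp add: \<zeta>_def real_le_lsqrt)
    have "\<xi>\<^sup>2 \<le> (2 * \<zeta>)\<^sup>2" using j \<zeta>2 by (simp add: power_mult_distrib)
    hence "\<xi> \<le> 2 * \<zeta>" by (rule power2_le_imp_le) (use \<zeta>1 in simp)
    hence half: "\<xi> / 2 \<le> \<zeta>" by simp
    have "(\<xi> - \<zeta>) * \<xi> \<le> (\<xi> - \<zeta>) * (\<xi> + \<zeta>)" using \<zeta>\<xi> \<zeta>1 by (intro mult_left_mono) auto
    also have "\<dots> = \<xi>\<^sup>2 - \<zeta>\<^sup>2" by (simp add: algebra_simps power2_eq_square)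
    also have "\<dots> \<le> 1" using j \<zeta>2 by simp
    finally have "\<bar>\<xi> - \<zeta>\<bar> \<le> 1 / \<xi>" using True \<zeta>\<xi> by (simp add: field_simps)
    also have "\<dots> \<le> \<xi> powr (- \<alpha> / 2)" by (rule inv[OF True])
    finally have "2 * pi * \<bar>\<xi> - \<zeta>\<bar> \<le> 2 * pi * \<xi> powr (- \<alpha> / 2)" by (intro mult_left_mono) auto
    hence lip: "cmod (fourier_measure \<mu> \<xi> - fourier_measure \<mu> \<zeta>) \<le> 2 * pi * \<xi> powr (- \<alpha> / 2)"
      using fourier_lipschitz[of \<xi> \<zeta>] by linarith
    have "\<zeta> powr (- \<alpha> / 2) \<le> (\<xi> / 2) powr (- \<alpha> / 2)"
      using half True \<alpha> by (intro powr_mono2') auto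
    also have "\<dots> = \<xi> powr (- \<alpha> / 2) * 2 powr (\<alpha> / 2)"
      using True by (simp add: powr_divide powr_minus_divide)
    also have "\<dots> \<le> \<xi> powr (- \<alpha> / 2) * 2 powr 1"
      using \<alpha> by (intro mult_left_mono powr_mono) auto
    finally have "C1 * \<zeta> powr (- \<alpha> / 2) \<le> C1 * (2 * \<xi> powr (- \<alpha> / 2))"
      using C1 by (intro mult_left_mono) auto
    hence "cmod (fourier_measure \<mu> \<zeta>) \<le> 2 * C1 * \<xi> powr (- \<alpha> / 2)"
      using net[of j] j by (simp add: \<zeta>_def)
    with lip norm_triangle_ineq[of "fourier_measure \<mu> \<xi> - fourier_measure \<mu> \<zeta>" "fourier_measure \<mu> \<zeta>"]
    show ?thesis by (simp add: C_def algebra_simps)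
  qed
  have "cmod (fourier_measure \<mu> \<xi>) \<le> C * \<bar>\<xi>\<bar> powr (- \<alpha> / 2)" if "\<xi> \<noteq> 0" for \<xi>
    using pos[of \<xi>] pos[of "- \<xi>"] fourier_minus[of \<xi>] that by (cases "\<xi> > 0") auto
  thus thesis using that by blast
qed

section \<open>Two-sided mass bounds for centered intervals\<close>

lemma bounded_interval_bounds:
  assumes "bounded_interval I"
  shows "I \<in> sets borel" "I \<subseteq> {Inf I..Sup I}" "{Inf I<..<Sup I} \<subseteq> I"
proof -
  have ne: "I \<noteq> {}" and bdd: "bdd_above I" "bdd_below I" and int: "is_interval I"
    using assms by (auto simp: bounded_interval_def bounded_imp_bdd_above bounded_imp_bdd_below)
  show "I \<in> sets borel" using int by (simp add: real_interval_borel_measurable)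
  show "I \<subseteq> {Inf I..Sup I}" using bdd by (auto intro: cInf_lower cSup_upper)
  show "{Inf I<..<Sup I} \<subseteq> I"
  proof
    fix x assume x: "x \<in> {Inf I<..<Sup I}"
    obtain a where "a \<in> I" "a < x" using x cInf_lessD[OF ne, of x] by auto
    moreover obtain c where "c \<in> I" "x < c" using x less_cSup_iff[OF ne bdd(1), of x] by auto
    ultimately show "x \<in> I" using int unfolding is_interval_1 by (meson less_imp_le)
  qed
qed

text \<open>At the level \<open>k\<close> with \<open>2 ^ k \<le> 1 / r < 2 ^ Suc k\<close>, the
  product of \<open>r powr \<alpha>\<close> and \<open>2 powr (\<alpha> * k)\<close> lies between
  1/2 and 1, and \<open>k + 1\<close> is comparable to \<open>ln (1 / r)\<close>. The upper bound
  counts intervals of level \<open>k\<close>, the lower bound finds one of level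
  \<open>k + 3\<close> inside \<open>I\<close>.\<close>

lemma (in dyadic_tree) regularity:
  assumes \<alpha>: "0 < \<alpha>" "\<alpha> < 1" and b: "b > 0" "B > 0"
    and lower: "\<And>k. b * (2 powr (\<alpha> * k) * (real k + 1)) \<le> 2 ^ s k"
    and upper: "\<And>k. 2 ^ s k \<le> B * (2 powr (\<alpha> * k) * (real k + 1))"
    and I: "bounded_interval I" "centered_in I (closure (T ` {0..<1}))"
    and r: "interval_length I = r" "0 < r" "r < 1 / 2"
  shows "measure \<mu> I \<le> (6 / b) * (r powr \<alpha> / ln (1 / r))"
    and "(1 / (80 * B)) * (r powr \<alpha> / ln (1 / r)) \<le> measure \<mu> I"
proof -
  note I' = bounded_interval_bounds[OF I(1)]
  define k where "k = nat \<lfloor>log 2 (1 / r)\<rfloor>"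
  \<comment> \<open>Since \<open>r < 1 / 2\<close>, the level is at least 1; this later absorbs
    additive constants into multiples of \<open>k\<close>.\<close>
  have "log 2 (1 / r) \<ge> 1" using r by (subst le_log_iff) (auto simp: field_simps)
  hence k: "real k \<le> log 2 (1 / r)" "log 2 (1 / r) < real (Suc k)" "k \<ge> 1"
    unfolding k_def by linarith+
  have k2: "2 ^ k \<le> 1 / r" "1 / r < 2 ^ Suc k"
    using k r by (simp_all add: le_log_iff log_less_iff powr_realpow del: of_nat_Suc power_Suc)
  have l0: "ln (1 / r) > 0" using r by simp
  have lk: "ln (1 / r) = log 2 (1 / r) * ln 2" by (simp add: log_def)
  have "ln (1 / r) \<le> (real k + 1) * 1"
    unfolding lk using k ln2_le_25_over_36 \<open>log 2 (1 / r) \<ge> 1\<close> by (intro mult_mono) auto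
  hence l1: "ln (1 / r) \<le> real k + 1" by simp
  have "real k * (1 / 2) \<le> ln (1 / r)"
    unfolding lk using k ln2_ge_two_thirds by (intro mult_mono) auto
  hence l2: "real k \<le> 2 * ln (1 / r)" by simp
  have pk: "(r * 2 ^ k) powr \<alpha> = r powr \<alpha> * 2 powr (\<alpha> * k)"
    using r by (simp add: powr_mult powr_powr mult.commute flip: powr_realpow)
  have "1 / 2 \<le> (1 / 2 :: real) powr \<alpha>"
    using powr_mono'[of \<alpha> 1 "1 / 2 :: real"] \<alpha> by simp
  also have "\<dots> \<le> (r * 2 ^ k) powr \<alpha>"
    using k2 r \<alpha> by (intro powr_mono2) (auto simp: field_simps)
  finally have p1: "1 \<le> 2 * (r powr \<alpha> * 2 powr (\<alpha> * k))" by (simp add: pk)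
  have "(r * 2 ^ k) powr \<alpha> \<le> 1 powr \<alpha>"
    using k2 r \<alpha> by (intro powr_mono2) (auto simp: field_simps)
  hence p2: "r powr \<alpha> * 2 powr (\<alpha> * k) \<le> 1" by (simp add: pk)

  have "measure \<mu> I \<le> 3 / 2 ^ s k"
    using I' k2 r by (intro measure_\<mu>_upper[of I "Inf I" "Sup I"])
      (auto simp: interval_length_def field_simps)
  also have "\<dots> \<le> 3 / (b * (2 powr (\<alpha> * k) * (real k + 1)))"
    using lower[of k] b by (intro divide_left_mono) auto
  also have "\<dots> \<le> (3 * (2 * (r powr \<alpha> * 2 powr (\<alpha> * k)))) / (b * (2 powr (\<alpha> * k) * (real k + 1)))"
    using p1 b by (intro divide_right_mono) auto
  also have "\<dots> = (6 / b) * (r powr \<alpha> / (real k + 1))"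
  proof -
    have "(3 * (2 * (x * P))) / (b * (P * n)) = (6 / b) * (x / n)" if "P > 0" "n > 0" for x P n :: real
      using b that by (simp add: field_simps)
    thus ?thesis by simp
  qed
  also have "\<dots> \<le> (6 / b) * (r powr \<alpha> / ln (1 / r))"
    using b l0 l1 by (intro mult_left_mono divide_left_mono) auto
  finally show "measure \<mu> I \<le> (6 / b) * (r powr \<alpha> / ln (1 / r))" .

  define L where "L = ln (1 / r)"
  have mid: "interval_midpoint I - r / 2 = Inf I" "interval_midpoint I + r / 2 = Sup I"
    using r by (simp_all add: interval_midpoint_def interval_length_def field_simps)
  \<comment> \<open>Three further levels give length at most \<open>r / 4\<close>, half of the
    radius \<open>r / 2\<close>. They cost at most 2^3 in the power, and k + 4 \<le> 5 k \<le> 10 L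
    in the linear factor, whence 80.\<close>
  have up3: "2 ^ s (k + 3) \<le> B * (8 * 2 powr (\<alpha> * k) * (10 * L))"
  proof -
    have "2 powr (\<alpha> * (k + 3)) = 2 powr (\<alpha> * k) * 2 powr (\<alpha> * 3)"
      by (simp add: distrib_left flip: powr_add)
    also have "\<dots> \<le> 2 powr (\<alpha> * k) * 2 powr 3"
      using \<alpha> by (intro mult_left_mono powr_mono) auto
    finally have "2 powr (\<alpha> * (k + 3)) \<le> 8 * 2 powr (\<alpha> * k)" by simp
    moreover have "real (k + 3) + 1 \<le> 10 * L" using k(3) l2 by (simp add: L_def)
    ultimately have "2 powr (\<alpha> * (k + 3)) * (real (k + 3) + 1) \<le> 8 * 2 powr (\<alpha> * k) * (10 * L)"
      by (intro mult_mono) auto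
    thus ?thesis using upper[of "k + 3"] b by (meson mult_left_mono less_imp_le order_trans)
  qed
  have "(1 / (80 * B)) * (r powr \<alpha> / L) = r powr \<alpha> / (B * (80 * L))" by simp
  also have "\<dots> = (r powr \<alpha> * 2 powr (\<alpha> * k)) / (B * (8 * 2 powr (\<alpha> * k) * (10 * L)))"
    by (simp add: field_simps)
  also have "\<dots> \<le> 1 / (B * (8 * 2 powr (\<alpha> * k) * (10 * L)))"
    using p2 b l0 by (intro divide_right_mono) (auto simp: L_def less_imp_le)
  also have "\<dots> \<le> 1 / 2 ^ s (k + 3)"
    using up3 b l0 by (intro divide_left_mono) (auto simp: L_def)
  also have "\<dots> \<le> measure \<mu> I"
  proof (rule measure_\<mu>_lower)
    show "interval_midpoint I \<in> closure (T ` {0..<1})" using I(2) by (simp add: centered_in_def)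
    show "1 / 2 ^ (k + 3) \<le> r / 2 / 2" using k2 r by (simp add: field_simps power_add)
    show "{interval_midpoint I - r / 2<..<interval_midpoint I + r / 2} \<subseteq> I"
      unfolding mid by (rule I')
  qed (use I' r in auto)
  finally show "(1 / (80 * B)) * (r powr \<alpha> / ln (1 / r)) \<le> measure \<mu> I" by (simp add: L_def)
qed

lemma split_sequence_exists:
  fixes \<alpha> :: real
  assumes \<alpha>: "0 < \<alpha>" "\<alpha> < 1"
  obtains s :: "nat \<Rightarrow> nat" and b :: real where "s 0 = 0"
    "\<And>k. s (Suc k) = s k \<or> s (Suc k) = Suc (s k)" "b > 0"
    "\<And>k. b * (2 powr (\<alpha> * k) * (real k + 1)) \<le> 2 ^ s k"
    "\<And>k. 2 ^ s k \<le> 2 powr (\<alpha> * k) * (real k + 1)"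
proof -
  have "2 powr (1 - \<alpha>) > 2 powr (0::real)" using \<alpha> by (intro powr_less_mono) auto
  then obtain K' where K': "inverse (real (Suc K')) < 2 powr (1 - \<alpha>) - 1"
    using reals_Archimedean[of "2 powr (1 - \<alpha>) - 1"] by auto
  define K where "K = real (Suc K')"
  have K: "K \<ge> 1" "1 + 1 / K < 2 powr (1 - \<alpha>)" using K' by (auto simp: K_def field_simps)
  \<comment> \<open>The exponent \<open>\<alpha> * k + log 2 (k + 1)\<close> would increase by more
    than 1 at the first step. Shifting by a large \<open>K\<close> keeps every increment of
    \<open>a\<close> at most 1, and dividing by \<open>K\<close> gives \<open>a 0 = 0\<close>; the
    floor then also increases by 0 or 1.\<close>
  define a where "a = (\<lambda>k::nat. \<alpha> * k + log 2 ((real k + K) / K))"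
  define s where "s = (\<lambda>k. nat \<lfloor>a k\<rfloor>)"
  have a_Suc: "a k \<le> a (Suc k)" "a (Suc k) \<le> a k + 1" for k
  proof -
    have "(real (Suc k) + K) / K = ((real k + K) / K) * (1 + 1 / (real k + K))"
    proof -
      have "(1 + n) / K = (n / K) * (1 + 1 / n)" if "n > 0" for n
        using K that by (simp add: field_simps)
      from this[of "real k + K"] show ?thesis using K by (simp add: add_ac)
    qed
    hence "log 2 ((real (Suc k) + K) / K) = log 2 ((real k + K) / K) + log 2 (1 + 1 / (real k + K))"
      using K by (simp only:, intro log_mult_pos) (auto simp: add_pos_pos)
    hence eq: "a (Suc k) = a k + (\<alpha> + log 2 (1 + 1 / (real k + K)))"
      by (simp add: a_def algebra_simps)
    have "0 \<le> 1 / (real k + K)" using K by simp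
    hence ge1: "1 \<le> 1 + 1 / (real k + K)" by (rule order_trans[OF _ add_left_mono, rotated]) simp
    hence "0 \<le> log 2 (1 + 1 / (real k + K))"
      by (subst zero_le_log_cancel_iff) (auto intro: less_le_trans[OF zero_less_one ge1])
    thus "a k \<le> a (Suc k)" using eq \<alpha> by simp
    have "1 + 1 / (real k + K) \<le> 1 + 1 / K" using K by (intro add_left_mono divide_left_mono) auto
    also note K(2)
    finally have "log 2 (1 + 1 / (real k + K)) \<le> log 2 (2 powr (1 - \<alpha>))"
      using K by (subst log_le_cancel_iff) (auto simp: add_pos_pos)
    also have "\<dots> = 1 - \<alpha>" by simp
    finally show "a (Suc k) \<le> a k + 1" using eq by simp
  qed
  have a0: "a k \<ge> 0" for k
    using K \<alpha> by (simp add: a_def)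
  have sa: "real (s k) \<le> a k" "a k - 1 < real (s k)" for k
    using a0[of k] by (simp_all add: s_def)
  have pa: "2 powr (a k) = 2 powr (\<alpha> * k) * ((real k + K) / K)" for k
    using K by (simp add: a_def powr_add)
  show thesis
  proof
    show "s 0 = 0" using K by (simp add: s_def a_def)
    show "s (Suc k) = s k \<or> s (Suc k) = Suc (s k)" for k
      using a_Suc[of k] a0[of k] unfolding s_def by linarith
    \<comment> \<open>\<open>K\<close> comes from the division inside \<open>a\<close>, the 2 from
      rounding down.\<close>
    show "1 / (2 * K) > 0" using K by simp
    show "1 / (2 * K) * (2 powr (\<alpha> * k) * (real k + 1)) \<le> 2 ^ s k" for k
    proof -
      have "1 / (2 * K) * (2 powr (\<alpha> * k) * (real k + 1)) \<le> 1 / (2 * K) * (2 powr (\<alpha> * k) * (real k + K))"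
        using K by (intro mult_left_mono) auto
      also have "\<dots> = 2 powr (a k - 1)" using K by (simp add: powr_diff pa)
      also have "\<dots> \<le> 2 powr (real (s k))" using sa[of k] by (intro powr_mono) auto
      finally show ?thesis by (simp add: powr_realpow)
    qed
    show "2 ^ s k \<le> 2 powr (\<alpha> * k) * (real k + 1)" for k
    proof -
      have "2 ^ s k = 2 powr (real (s k))" by (simp add: powr_realpow)
      also have "\<dots> \<le> 2 powr (a k)" using sa[of k] by (intro powr_mono) auto
      also have "\<dots> \<le> 2 powr (\<alpha> * k) * (real k + 1)"
        unfolding pa
      proof (intro mult_left_mono)
        have "real k * 1 \<le> real k * K" using K by (intro mult_left_mono) auto
        thus "(real k + K) / K \<le> real k + 1" using K by (simp add: divide_le_eq algebra_simps)
      qed simp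
      finally show ?thesis .
    qed
  qed
qed

text \<open>Levels are built by dependent choice. At a one-child level the positions are already
  known, so the phases at all net frequencies are fixed unimodular numbers and
  \<open>balancing_signs\<close> applies to them.\<close>

lemma balanced_dyadic_tree_exists:
  assumes s0: "s 0 = 0" and s: "\<And>k. s (Suc k) = s k \<or> s (Suc k) = Suc (s k)"
  obtains y where "balanced_dyadic_tree s y"
proof -
  define bal where "bal = (\<lambda>k (x :: nat \<Rightarrow> nat) (x' :: nat \<Rightarrow> nat). \<forall>j::nat.
    cmod (\<Sum>n<2 ^ s k. of_real (2 * (real (x' n) - 2 * real (x n)) - 1) *
         cis (- (2 * pi * sqrt (real j) * (real (x n) / 2 ^ k))))
      \<le> 9 * sqrt (2 ^ s k * ln (real j + 2)))"
  define Q where "Q = (\<lambda>k x x'. if s (Suc k) = Suc (s k)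
     then \<forall>n. x' n = 2 * x (n div 2) + n mod 2
     else (\<forall>n. x' n \<in> {2 * x n, 2 * x n + 1}) \<and> bal k x x')"
  have "\<exists>y. \<forall>k. (k = 0 \<longrightarrow> y k 0 = (0::nat)) \<and> Q k (y k) (y (Suc k))"
  proof (rule dependent_nat_choice)
    fix x :: "nat \<Rightarrow> nat" and k :: nat
    show "\<exists>x'. (Suc k = 0 \<longrightarrow> x' 0 = 0) \<and> Q k x x'"
    proof (cases "s (Suc k) = Suc (s k)")
      case True
      thus ?thesis by (auto simp: Q_def)
    next
      case False
      obtain \<epsilon> where \<epsilon>: "\<And>q. \<epsilon> q \<in> {-1, 1::real}"
        "\<And>j. cmod (\<Sum>q\<in>{..<2 ^ s k}. of_real (\<epsilon> q) * cis (- (2 * pi * sqrt (real j) * (real (x q) / 2 ^ k))))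
           \<le> 9 * sqrt (card {..<(2::nat) ^ s k} * ln (real j + 2))"
      proof (rule balancing_signs[of "{..<(2::nat) ^ s k}"
              "\<lambda>j q. cis (- (2 * pi * sqrt (real j) * (real (x q) / 2 ^ k)))"])
        have "0 \<in> {..<(2::nat) ^ s k}" by simp
        thus "{..<(2::nat) ^ s k} \<noteq> {}" by blast
      qed auto
      \<comment> \<open>Sign 1 keeps the right half, sign -1 the left.\<close>
      define x' where "x' = (\<lambda>n. 2 * x n + (if \<epsilon> n = 1 then 1 else 0))"
      have eq: "2 * (real (x' n) - 2 * real (x n)) - 1 = \<epsilon> n" for n
        using \<epsilon>(1)[of n] by (auto simp: x'_def)
      have "bal k x x'" unfolding bal_def eq using \<epsilon>(2) by simp
      moreover have "x' n \<in> {2 * x n, 2 * x n + 1}" for n by (simp add: x'_def)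
      ultimately show ?thesis using False by (auto simp: Q_def)
    qed
  qed auto
  then obtain y where y: "y 0 0 = 0" "\<And>k. Q k (y k) (y (Suc k))" by metis
  have "balanced_dyadic_tree s y"
  proof
    fix k
    show "s (Suc k) = Suc (s k) \<and> (\<forall>n. y (Suc k) n = 2 * y k (n div 2) + n mod 2) \<or>
          s (Suc k) = s k \<and> (\<forall>n. y (Suc k) n \<in> {2 * y k n, 2 * y k n + 1})"
      using s[of k] y(2)[of k] by (auto simp: Q_def)
  next
    fix k j assume "s (Suc k) = s k"
    thus "cmod (\<Sum>n<2 ^ s k. of_real (2 * (real (y (Suc k) n) - 2 * real (y k n)) - 1) *
         cis (- (2 * pi * sqrt (real j) * (real (y k n) / 2 ^ k))))
      \<le> 9 * sqrt (2 ^ s k * ln (real j + 2))"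
      using y(2)[of k] by (simp add: Q_def bal_def)
  qed (use s0 y in auto)
  thus thesis by (rule that)
qed

theorem theorem1:
  fixes \<alpha> :: real
  assumes "0 < \<alpha>" and "\<alpha> < 1"
  shows "\<exists>(E :: real set) (\<mu> :: real measure) (c :: real) (C :: real).
    compact E \<and>
    prob_space \<mu> \<and> sets \<mu> = sets borel \<and> measure \<mu> E = 1 \<and>
    0 < c \<and> c \<le> C \<and>
    (\<forall>\<xi>::real. \<xi> \<noteq> 0 \<longrightarrow> cmod (fourier_measure \<mu> \<xi>) \<le> C * \<bar>\<xi>\<bar> powr (- \<alpha> / 2)) \<and>
    (\<forall>I::real set.
       bounded_interval I \<and> centered_in I E \<and> 0 < interval_length I \<and> interval_length I < 1 / 2 \<longrightarrow>
         c * (interval_length I powr \<alpha> / ln (1 / interval_length I)) \<le> measure \<mu> I \<and>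
         measure \<mu> I \<le> C * (interval_length I powr \<alpha> / ln (1 / interval_length I)))"
proof -
  obtain s b where s: "s 0 = 0" "\<And>k. s (Suc k) = s k \<or> s (Suc k) = Suc (s k)"
    and b: "b > 0" "\<And>k. b * (2 powr (\<alpha> * k) * (real k + 1)) \<le> 2 ^ s k"
      "\<And>k. 2 ^ s k \<le> 2 powr (\<alpha> * k) * (real k + 1)"
    using split_sequence_exists[OF assms] by metis
  obtain y where "balanced_dyadic_tree s y"
    using balanced_dyadic_tree_exists[of s] s by metis
  then interpret balanced_dyadic_tree s y .
  obtain C0 where C0: "\<And>\<xi>. \<xi> \<noteq> 0 \<Longrightarrow> cmod (fourier_measure \<mu> \<xi>) \<le> C0 * \<bar>\<xi>\<bar> powr (- \<alpha> / 2)"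
    using fourier_decay[OF assms b(1,2)] by metis
  \<comment> \<open>\<open>C0\<close> serves the decay and \<open>6 / b\<close> the upper mass
    bound; the entry 1 ensures \<open>1 / 80 \<le> C\<close>, where \<open>1 / 80\<close> is the
    lower constant for \<open>B = 1\<close>.\<close>
  define C where "C = max C0 (max (6 / b) 1)"
  have CC: "C0 \<le> C" "6 / b \<le> C" "1 \<le> C" by (auto simp: C_def)
  have fourier: "cmod (fourier_measure \<mu> \<xi>) \<le> C * \<bar>\<xi>\<bar> powr (- \<alpha> / 2)" if "\<xi> \<noteq> 0" for \<xi>
    using C0[OF that] mult_right_mono[OF CC(1), of "\<bar>\<xi>\<bar> powr (- \<alpha> / 2)"] by simp
  have reg: "(1 / 80) * (interval_length I powr \<alpha> / ln (1 / interval_length I)) \<le> measure \<mu> I \<and>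
         measure \<mu> I \<le> C * (interval_length I powr \<alpha> / ln (1 / interval_length I))"
    if "bounded_interval I" "centered_in I (closure (T ` {0..<1}))"
       "0 < interval_length I" "interval_length I < 1 / 2" for I
  proof -
    have up: "2 ^ s k \<le> 1 * (2 powr (\<alpha> * k) * (real k + 1))" for k using b(3)[of k] by simp
    note * = regularity[OF assms b(1) zero_less_one b(2) up that(1,2) refl that(3,4)]
    have "0 \<le> interval_length I powr \<alpha> / ln (1 / interval_length I)" using that(3,4) by simp
    from mult_right_mono[OF CC(2) this] * show ?thesis by simp
  qed
  show ?thesis
    by (rule exI[of _ "closure (T ` {0..<1})"], rule exI[of _ \<mu>], rule exI[of _ "1 / 80"], rule exI[of _ C])
       (use fourier reg CC compact_support measure_support prob_space_\<mu> in auto)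
qed

end
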